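(* Let $X=\{X(t),t\in T\}$ be an i.d. process (with trivial Gaussian component). Let $\{f_t^{(i)},t\in T\}$, $i=1,2$, be two minimal spectral representations of $X$ defined on $\sigma$-finite measure spaces $(\Omega_i,\mathcal B_i,\mu_i)$, $i=1,2$. (i) If $(\Omega_1,\mathcal B_1,\mu_1)$ is a $\sigma$-finite Borel space, then there is a measurable map $\Phi:\Omega_2\to\Omega_1$ such that $\mu_1=\mu_2\circ\Phi^{-1}$ and for all $t\in T$, $$f_t^{(2)}(\omega)=f_t^{(1)}\circ\Phi(\omega)\quad\text{for }\mu_2\text{-a.a. }\omega\in\Omega_2.$$ (ii) If both $(\Omega_i,\mathcal B_i,\mu_i)$, $i=1,2$, are $\sigma$-finite Borel spaces, then the mapping $\Phi$ in part (i) is a measure space isomorphism and it is unique modulo null sets.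
   Context: $\stackrel{d}{=}$ denotes equality of finite-dimensional distributions. A real-valued process $X=\{X(t),t\in T\}$ on an arbitrary index set $T$ is infinitely divisible (i.d.) if for all $n\in\mathbb N$ it can be represented in distribution as a sum of $n$ i.i.d. processes. It has trivial Gaussian component if the Gaussian part in the L\'evy triplet of every finite-dimensional distribution vanishes. For a $\sigma$-finite measure space $(\Omega,\mathcal B,\mu)$, $\mathcal L^+=\mathcal L^+(\Omega,\mathcal B,\mu)$ is the set of measurable $f:\Omega\to\mathbb R$ with $\int_\Omega\min\{1,|f|^2\}\,d\mu<\infty$ (functions equal $\mu$-a.e. are identified). Let $\Pi_\mu=\{U_i,i\in J\}$ be a Poisson point process on $(\Omega,\mathcal B)$ with intensity $\mu$, and let $a(u)=u$ for $|u|\le1$, $a(u)=1$ for $u>1$, $a(u)=-1$ for $u<-1$. For $f\in\mathcal L^+$ define (a.s. limit) $$I(f):=\lim_{\varepsilon\to0+}\Big\{\sum_{i\in J}f(U_i)\mathbf 1_{\{|f(U_i)|>\varepsilon\}}-\int_{\{|f|>\varepsilon\}}a(f)\,d\mu\Big\}.$$ A family $\{f_t,t\in T\}\subset\mathcal L^+(\Omega,\mathcal B,\mu)$ is a spectral representation of $X$ if $\{X(t),t\in T\}\stackrel{d}{=}\{I(f_t)+c(t),t\in T\}$ for some function $c:T\to\mathbb R$. It is minimal if (a) for every $B\in\mathcal B$ there is $A\in\sigma\{f_t,t\in T\}$ with $\mu(A\Delta B)=0$; and (b) there is no $B\in\mathcal B$ with $\mu(B)>0$ such that for every $t\in T$,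 $f_t=0$ $\mu$-a.e. on $B$. A measurable space is a Borel space if it is isomorphic (via a bimeasurable bijection) to a complete separable metric space with its Borel $\sigma$-algebra; endowed with a $\sigma$-finite measure it is a $\sigma$-finite Borel space. A measure space isomorphism (modulo null sets) between $(\Omega,\mathcal B,\mu)$ and $(\Omega',\mathcal B',\mu')$ is a bijection $\Phi:\Omega\setminus A\to\Omega'\setminus A'$, with $A\in\mathcal B$, $A'\in\mathcal B'$ null sets, such that $\Phi,\Phi^{-1}$ are measurable and $\mu(E)=\mu'(\Phi(E))$ for all measurable $E\subset\Omega\setminus A$. Two isomorphisms are equal modulo null sets if they agree $\mu$-a.e. *)

theory Defs
  imports "HOL-Probability.Probability"
begin

section \<open>Processes\<close>

definition fdd_equal ::
  "'t set \<Rightarrow> 'p measure \<Rightarrow> ('t \<Rightarrow> 'p \<Rightarrow> real) \<Rightarrow> 'q measure \<Rightarrow> ('t \<Rightarrow> 'q \<Rightarrow> real) \<Rightarrow> bool" where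
  "fdd_equal T P X Q Y \<longleftrightarrow>
    (\<forall>F. finite F \<and> F \<subseteq> T \<longrightarrow>
      distr P (Pi\<^sub>M F (\<lambda>_. borel)) (\<lambda>\<omega>. \<lambda>t\<in>F. X t \<omega>) =
      distr Q (Pi\<^sub>M F (\<lambda>_. borel)) (\<lambda>\<omega>. \<lambda>t\<in>F. Y t \<omega>))"

text \<open>
  The sample space type \<open>nat \<Rightarrow> 't \<Rightarrow> real\<close> of the summands is no restriction: \<open>n\<close> i.i.d. processes
  indexed by \<open>T\<close> can be realised as the coordinates of a product of \<open>n\<close> copies of their law.
\<close>

definition infinitely_divisible :: "'t set \<Rightarrow> 'p measure \<Rightarrow> ('t \<Rightarrow> 'p \<Rightarrow> real) \<Rightarrow> bool" where
  "infinitely_divisible T P X \<longleftrightarrow>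
    (\<forall>n\<ge>1. \<exists>(Q :: (nat \<Rightarrow> 't \<Rightarrow> real) measure) (Y :: nat \<Rightarrow> 't \<Rightarrow> (nat \<Rightarrow> 't \<Rightarrow> real) \<Rightarrow> real).
      prob_space Q \<and>
      prob_space.indep_vars Q (\<lambda>_. Pi\<^sub>M T (\<lambda>_. borel)) (\<lambda>k \<omega>. \<lambda>t\<in>T. Y k t \<omega>) {..<n} \<and>
      (\<forall>k<n. \<forall>l<n. fdd_equal T Q (Y k) Q (Y l)) \<and>
      fdd_equal T P X Q (\<lambda>t \<omega>. \<Sum>k<n. Y k t \<omega>))"

definition trunc :: "real \<Rightarrow> real" where
  "trunc u = (if \<bar>u\<bar> \<le> 1 then u else if u > 1 then 1 else -1)"

text \<open>
  L\'evy--Khintchine representation of the law of \<open>(X t)\<^sub>t\<^sub>\<in>\<^sub>F\<close>, with \<open>trunc\<close> applied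
  coordinatewise as truncation function; another choice would only change the shift \<open>\<gamma>\<close>.
\<close>

definition levy_triplet ::
  "'p measure \<Rightarrow> ('t \<Rightarrow> 'p \<Rightarrow> real) \<Rightarrow> 't set \<Rightarrow>
   ('t \<Rightarrow> real) \<Rightarrow> ('t \<Rightarrow> 't \<Rightarrow> real) \<Rightarrow> ('t \<Rightarrow> real) measure \<Rightarrow> bool" where
  "levy_triplet P X F \<gamma> \<Sigma> \<nu> \<longleftrightarrow>
    (\<forall>s\<in>F. \<forall>t\<in>F. \<Sigma> s t = \<Sigma> t s) \<and>
    (\<forall>\<theta> :: 't \<Rightarrow> real. (\<Sum>s\<in>F. \<Sum>t\<in>F. \<theta> s * \<Sigma> s t * \<theta> t) \<ge> 0) \<and>
    sets \<nu> = sets (Pi\<^sub>M F (\<lambda>_. borel)) \<and>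
    emeasure \<nu> {\<lambda>t\<in>F. 0} = 0 \<and>
    integrable \<nu> (\<lambda>x. min 1 (\<Sum>t\<in>F. (x t)\<^sup>2)) \<and>
    (\<forall>\<theta> :: 't \<Rightarrow> real.
      (\<integral>\<omega>. iexp (\<Sum>t\<in>F. \<theta> t * X t \<omega>) \<partial>P) =
      exp (\<i> * of_real (\<Sum>t\<in>F. \<theta> t * \<gamma> t)
           - of_real ((\<Sum>s\<in>F. \<Sum>t\<in>F. \<theta> s * \<Sigma> s t * \<theta> t) / 2)
           + (\<integral>x. (iexp (\<Sum>t\<in>F. \<theta> t * x t) - 1
                   - \<i> * of_real (\<Sum>t\<in>F. \<theta> t * trunc (x t))) \<partial>\<nu>)))"

definition trivial_gaussian_component :: "'t set \<Rightarrow> 'p measure \<Rightarrow> ('t \<Rightarrow> 'p \<Rightarrow> real) \<Rightarrow> bool" where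
  "trivial_gaussian_component T P X \<longleftrightarrow>
    (\<forall>F. finite F \<and> F \<subseteq> T \<longrightarrow>
      (\<exists>\<gamma> \<Sigma> \<nu>. levy_triplet P X F \<gamma> \<Sigma> \<nu> \<and> (\<forall>s\<in>F. \<forall>t\<in>F. \<Sigma> s t = 0)))"

section \<open>Poisson point processes and stochastic integrals\<close>

text \<open>
  A point process is an enumerated random family \<open>(U i \<omega>)\<close>, \<open>i \<in> J \<omega>\<close>, with a random index set
  \<open>J \<omega> \<subseteq> \<nat>\<close>; coinciding points are counted with multiplicity. The values \<open>U i \<omega>\<close> for
  \<open>i \<notin> J \<omega>\<close> are irrelevant.
\<close>

definition point_count ::
  "('q \<Rightarrow> nat set) \<Rightarrow> (nat \<Rightarrow> 'q \<Rightarrow> 'a) \<Rightarrow> 'a set \<Rightarrow> 'q \<Rightarrow> ennreal" where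
  "point_count J U B \<omega> = emeasure (count_space UNIV) {i \<in> J \<omega>. U i \<omega> \<in> B}"

definition poisson_point_process ::
  "'q measure \<Rightarrow> 'a measure \<Rightarrow> ('q \<Rightarrow> nat set) \<Rightarrow> (nat \<Rightarrow> 'q \<Rightarrow> 'a) \<Rightarrow> bool" where
  "poisson_point_process Q M J U \<longleftrightarrow>
    prob_space Q \<and>
    (\<forall>\<omega>\<in>space Q. \<forall>i\<in>J \<omega>. U i \<omega> \<in> space M) \<and>
    (\<forall>i. \<forall>B\<in>sets M. {\<omega> \<in> space Q. i \<in> J \<omega> \<and> U i \<omega> \<in> B} \<in> sets Q) \<and>
    (\<forall>B\<in>sets M. emeasure M B < \<infinity> \<longrightarrow>
      (\<forall>k::nat. measure Q {\<omega> \<in> space Q. point_count J U B \<omega> = of_nat k} =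
        measure M B ^ k / fact k * exp (- measure M B))) \<and>
    (\<forall>B\<in>sets M. emeasure M B = \<infinity> \<longrightarrow> (AE \<omega> in Q. point_count J U B \<omega> = \<infinity>)) \<and>
    (\<forall>(n::nat) B. (\<forall>k<n. B k \<in> sets M) \<and> disjoint_family_on B {..<n} \<longrightarrow>
      prob_space.indep_vars Q (\<lambda>_. borel) (\<lambda>k. point_count J U (B k)) {..<n})"

definition L_plus :: "'a measure \<Rightarrow> ('a \<Rightarrow> real) set" where
  "L_plus M = {f \<in> borel_measurable M. integrable M (\<lambda>x. min 1 (\<bar>f x\<bar>\<^sup>2))}"

text \<open>
  \<open>Y\<close> is (a version of) the a.s. limit defining \<open>I(f)\<close>. For \<open>f \<in> L_plus M\<close> the sum has, almost
  surely, only finitely many terms for every \<open>\<epsilon> > 0\<close>.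
\<close>

definition is_poisson_integral ::
  "'q measure \<Rightarrow> 'a measure \<Rightarrow> ('q \<Rightarrow> nat set) \<Rightarrow> (nat \<Rightarrow> 'q \<Rightarrow> 'a) \<Rightarrow>
   ('a \<Rightarrow> real) \<Rightarrow> ('q \<Rightarrow> real) \<Rightarrow> bool" where
  "is_poisson_integral Q M J U f Y \<longleftrightarrow>
    Y \<in> borel_measurable Q \<and>
    (AE \<omega> in Q.
      ((\<lambda>\<epsilon>. (\<Sum>i | i \<in> J \<omega> \<and> \<bar>f (U i \<omega>)\<bar> > \<epsilon>. f (U i \<omega>))
            - (LINT x:{x \<in> space M. \<bar>f x\<bar> > \<epsilon>}|M. trunc (f x)))
        \<longlongrightarrow> Y \<omega>) (at_right 0))"

section \<open>Minimal spectral representations\<close>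

text \<open>
  The law of \<open>(I(f t))\<^sub>t\<close> does not depend on the realisation of the Poisson process. Every such
  process can be realised on the configuration type \<open>nat \<Rightarrow> 'a option\<close>, by sending the \<open>i\<close>-th
  point to \<open>Some (U i \<omega>)\<close> if \<open>i \<in> J \<omega>\<close> and to \<open>None\<close> otherwise.
\<close>

definition spectral_representation ::
  "'t set \<Rightarrow> 'p measure \<Rightarrow> ('t \<Rightarrow> 'p \<Rightarrow> real) \<Rightarrow> 'a measure \<Rightarrow> ('t \<Rightarrow> 'a \<Rightarrow> real) \<Rightarrow> bool" where
  "spectral_representation T P X M f \<longleftrightarrow>
    (\<forall>t\<in>T. f t \<in> L_plus M) \<and>
    (\<exists>(Q :: (nat \<Rightarrow> 'a option) measure) J U I c.
      poisson_point_process Q M J U \<and>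
      (\<forall>t\<in>T. is_poisson_integral Q M J U (f t) (I t)) \<and>
      fdd_equal T P X Q (\<lambda>t \<omega>. I t \<omega> + c t))"

definition minimal_family :: "'t set \<Rightarrow> 'a measure \<Rightarrow> ('t \<Rightarrow> 'a \<Rightarrow> real) \<Rightarrow> bool" where
  "minimal_family T M f \<longleftrightarrow>
    (\<forall>B\<in>sets M.
      \<exists>A \<in> sigma_sets (space M) (\<Union>t\<in>T. {f t -` S \<inter> space M | S. S \<in> sets borel}).
        emeasure M ((A - B) \<union> (B - A)) = 0) \<and>
    \<not> (\<exists>B\<in>sets M. emeasure M B > 0 \<and> (\<forall>t\<in>T. AE x in M. x \<in> B \<longrightarrow> f t x = 0))"

definition minimal_spectral_representation ::
  "'t set \<Rightarrow> 'p measure \<Rightarrow> ('t \<Rightarrow> 'p \<Rightarrow> real) \<Rightarrow> 'a measure \<Rightarrow> ('t \<Rightarrow> 'a \<Rightarrow> real) \<Rightarrow> bool" where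
  "minimal_spectral_representation T P X M f \<longleftrightarrow>
    spectral_representation T P X M f \<and> minimal_family T M f"

section \<open>Borel spaces and isomorphisms modulo null sets\<close>

definition bimeasurable_bijection :: "'a measure \<Rightarrow> 'b measure \<Rightarrow> ('a \<Rightarrow> 'b) \<Rightarrow> bool" where
  "bimeasurable_bijection M N \<phi> \<longleftrightarrow>
    bij_betw \<phi> (space M) (space N) \<and>
    \<phi> \<in> measurable M N \<and> the_inv_into (space M) \<phi> \<in> measurable N M"

text \<open>
  Since \<open>\<phi>\<close> is a bijection, the metric space may be taken to have its points in \<open>'a\<close>. It is
  required to be nonempty: there is no map from a nonempty null space to an empty one.
\<close>

definition borel_space :: "'a measure \<Rightarrow> bool" where
  "borel_space M \<longleftrightarrow>
    (\<exists>(m :: 'a metric) \<phi>.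
      mspace m \<noteq> {} \<and> mcomplete_of m \<and> separable_space (mtopology_of m) \<and>
      bimeasurable_bijection M (sigma (mspace m) {G. openin (mtopology_of m) G}) \<phi>)"

definition sigma_finite_borel_space :: "'a measure \<Rightarrow> bool" where
  "sigma_finite_borel_space M \<longleftrightarrow> sigma_finite_measure M \<and> borel_space M"

definition measure_space_isomorphism :: "'a measure \<Rightarrow> 'b measure \<Rightarrow> ('a \<Rightarrow> 'b) \<Rightarrow> bool" where
  "measure_space_isomorphism M N \<Phi> \<longleftrightarrow>
    (\<exists>A\<in>null_sets M. \<exists>A'\<in>null_sets N.
      bimeasurable_bijection
        (restrict_space M (space M - A)) (restrict_space N (space N - A')) \<Phi> \<and>
      (\<forall>E\<in>sets M. E \<subseteq> space M - A \<longrightarrow> emeasure M E = emeasure N (\<Phi> ` E)))"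

definition intertwines ::
  "'t set \<Rightarrow> 'a measure \<Rightarrow> ('t \<Rightarrow> 'a \<Rightarrow> real) \<Rightarrow> 'b measure \<Rightarrow> ('t \<Rightarrow> 'b \<Rightarrow> real) \<Rightarrow> ('b \<Rightarrow> 'a) \<Rightarrow> bool"
where
  "intertwines T M1 f1 M2 f2 \<Phi> \<longleftrightarrow>
    \<Phi> \<in> measurable M2 M1 \<and>
    M1 = distr M2 M1 \<Phi> \<and>
    (\<forall>t\<in>T. AE \<omega> in M2. f2 t \<omega> = f1 t (\<Phi> \<omega>))"

end

theory Submission
  imports Defs
begin

text \<open>
  Fix a spectral representation \<open>f\<close> over \<open>M\<close>. The sums over the Poisson points that define the
  integrals \<open>I(f t)\<close> are compound Poisson up to a compensating constant, and passing to the limit in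
  their characteristic functions gives the L\'evy--Khintchine formula: for finite \<open>F\<close>, the characteristic
  function of \<open>(I(f t) + c t)\<^sub>t\<^sub>\<in>\<^sub>F\<close> at \<open>\<theta>\<close> is \<open>exp (\<psi>(\<theta>))\<close>, where

  \<open>\<psi>(\<theta>) = \<i> (\<Sum>t\<in>F. \<theta> t * c t) + \<integral>x. exp (\<i> \<Sum>t\<in>F. \<theta> t * f t x) - 1 - \<i> (\<Sum>t\<in>F. \<theta> t * trunc (f t x)) \<partial>M\<close>.

  So the image of \<open>M\<close> under \<open>(f t)\<^sub>t\<^sub>\<in>\<^sub>F\<close> is, off the origin, the L\'evy measure of \<open>(X t)\<^sub>t\<^sub>\<in>\<^sub>F\<close>.
  Two representations have exponents with the same exponential; being continuous along rays and zero
  at the origin, the exponents themselves agree (\<open>levy_exponent_unique\<close>). A second difference in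
  direction \<open>h e\<^sub>s\<close> turns \<open>\<psi>\<close> into the Fourier transform of the finite measure with density
  \<open>1 - cos (h f\<^sub>s)\<close>, and finite measures are determined by their Fourier transform. Letting \<open>s\<close> and \<open>h\<close>
  vary, the two families have the same image measure off the origin
  (\<open>distr_eq_of_levy_exponent_eq\<close>). As the family does not vanish identically on any set of positive measure,
  the origin is a null set once suitable countably many coordinates are retained
  (\<open>countable_subfamily_with_full_support\<close>), so for suitable countable \<open>S\<close> the families
  \<open>F\<^sub>i = (f\<^sub>i t)\<^sub>t\<^sub>\<in>\<^sub>S\<close> have the same law on the product space \<open>\<real>\<^sup>S\<close>.

  The other half of minimality says that the coordinates generate the \<open>\<sigma>\<close>-algebra up to null sets. If the space is
  Borel, this produces a countable \<open>S\<close> and a measurable \<open>g\<close> from \<open>\<real>\<^sup>S\<close> to the space with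
  \<open>g \<circ> F = id\<close> almost everywhere (\<open>countable_subfamily_retraction\<close>): approximate the identity by maps
  with countably many values, replace their level sets by sets that depend on \<open>F\<close> alone, and take the limit
  by completeness.

  Now let \<open>g\<^sub>1\<close> be such a left inverse for the first representation. Then \<open>\<Phi> = g\<^sub>1 \<circ> F\<^sub>2\<close> carries \<open>M2\<close> to \<open>M1\<close>
  because \<open>F\<^sub>1\<close> and \<open>F\<^sub>2\<close> have the same law, and for \<open>t\<close> outside \<open>S\<close> the relation
  \<open>f\<^sub>1 t = f\<^sub>1 t \<circ> g\<^sub>1 \<circ> F\<^sub>1\<close> is a statement about the law of the family indexed by \<open>insert t S\<close>, hence passes to the second
  representation (\<open>intertwines_retraction\<close>). Any other intertwining map \<open>\<Psi>\<close> satisfies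
  \<open>F\<^sub>1 \<circ> \<Psi> = F\<^sub>2\<close> almost everywhere, and applying \<open>g\<^sub>1\<close> gives \<open>\<Psi> = \<Phi>\<close>. If \<open>M2\<close> is Borel as well, a left
  inverse \<open>g\<^sub>2\<close> of \<open>F\<^sub>2\<close> yields the inverse isomorphism \<open>g\<^sub>2 \<circ> F\<^sub>1\<close>
  (\<open>intertwines_imp_isomorphism\<close>).
\<close>

section \<open>Finite measures with equal Fourier transforms\<close>

text \<open>
  Evaluating at \<open>0\<close> shows that the total masses agree; after normalising, this is the uniqueness
  theorem for characteristic functions of probability measures.
\<close>

lemma finite_measure_eq_of_char_eq:
  fixes M N :: "real measure"
  assumes "finite_measure M" "finite_measure N"
    and sets: "sets M = sets borel" "sets N = sets borel"
    and char: "char M = char N"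
  shows "M = N"
proof -
  interpret M: finite_measure M by fact
  interpret N: finite_measure N by fact
  have sp: "space M = UNIV" "space N = UNIV"
    using sets sets_eq_imp_space_eq by (metis space_borel)+
  define c where "c = measure M UNIV"
  have "char M 0 = measure M UNIV" "char N 0 = measure N UNIV"
    by (simp_all add: char_def sp scaleR_conv_of_real)
  then have c: "measure N UNIV = c"
    using char c_def by simp
  show ?thesis
  proof (cases "c = 0")
    case True
    then have z: "emeasure M UNIV = 0" "emeasure N UNIV = 0"
      using c by (simp_all add: M.emeasure_eq_measure N.emeasure_eq_measure c_def)
    show ?thesis
    proof (rule measure_eqI)
      fix A assume "A \<in> sets M"
      have "emeasure M A \<le> emeasure M UNIV" "emeasure N A \<le> emeasure N UNIV"
        using emeasure_space[of M A] emeasure_space[of N A] sp by simp_all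
      then show "emeasure M A = emeasure N A"
        using z by simp
    qed (simp add: sets)
  next
    case False
    then have cpos: "c > 0"
      by (simp add: c_def less_le)
    define R where "R = (\<lambda>K :: real measure. density K (\<lambda>_. ennreal (1 / c)))"
    have em: "emeasure (R K) A = ennreal (1 / c) * emeasure K A"
      if "A \<in> sets K" for K A
      using that by (simp add: R_def emeasure_density_const)
    have dist: "real_distribution (R K)"
      if "finite_measure K" "sets K = sets borel" "space K = UNIV" "measure K UNIV = c" for K
    proof -
      interpret K: finite_measure K by fact
      have "emeasure (R K) (space (R K)) = ennreal (1 / c) * ennreal c"
        using that em[of UNIV K] by (simp add: R_def K.emeasure_eq_measure)
      also have "\<dots> = 1"
        using cpos by (simp flip: ennreal_mult)
      finally have "prob_space (R K)"
        by (rule prob_spaceI)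
      then show ?thesis
        using that by (simp add: real_distribution_def real_distribution_axioms_def R_def)
    qed
    have ch: "char (R K) t = char K t / c" if "sets K = sets borel" for K t
    proof -
      have [measurable_cong]: "sets K = sets borel" by fact
      show ?thesis
        unfolding char_def R_def
        using cpos by (subst integral_density) (auto simp: scaleR_conv_of_real)
    qed
    have "R M = R N"
      by (rule Levy_uniqueness) (use dist sets sp c c_def ch char assms in auto)
    show ?thesis
    proof (rule measure_eqI)
      fix A assume A: "A \<in> sets M"
      have "ennreal (1 / c) * emeasure M A = ennreal (1 / c) * emeasure N A"
        using em[of A M] em[of A N] A sets \<open>R M = R N\<close> by simp
      then show "emeasure M A = emeasure N A"
        using cpos by (auto simp: ennreal_mult_cancel_left)
    qed (simp add: sets)
  qed
qed

text \<open>
  The weights \<open>w\<close> and \<open>v\<close> let one-dimensional uniqueness see a further function: with weights built from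
  \<open>cos\<close> and \<open>sin\<close> of a second variable it drives the passage to several dimensions below.
\<close>

lemma weighted_integral_eq_of_char_eq:
  fixes f w :: "'a \<Rightarrow> real" and g v :: "'b \<Rightarrow> real"
  assumes fin: "finite_measure M" "finite_measure N"
    and [measurable]: "f \<in> borel_measurable M" "w \<in> borel_measurable M"
      "g \<in> borel_measurable N" "v \<in> borel_measurable N"
    and w: "\<And>x. 0 \<le> w x" "\<And>x. w x \<le> C" and v: "\<And>x. 0 \<le> v x" "\<And>x. v x \<le> C"
    and char: "\<And>u. (\<integral>x. w x *\<^sub>R iexp (u * f x) \<partial>M) = (\<integral>x. v x *\<^sub>R iexp (u * g x) \<partial>N)"
    and [measurable]: "S \<in> sets borel"
  shows "(\<integral>x. indicator S (f x) * w x \<partial>M) = (\<integral>x. indicator S (g x) * v x \<partial>N)"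
proof -
  have fin_distr: "finite_measure (distr (density K (\<lambda>x. ennreal (k x))) borel h)"
    if K: "finite_measure K" and [measurable]: "k \<in> borel_measurable K" "h \<in> borel_measurable K"
      and k: "\<And>x. 0 \<le> k x" "\<And>x. k x \<le> C" for K :: "'c measure" and k h :: "'c \<Rightarrow> real"
  proof -
    interpret K: finite_measure K by fact
    have "emeasure (density K (\<lambda>x. ennreal (k x))) (space K) = (\<integral>\<^sup>+x. ennreal (k x) \<partial>K)"
      by (subst emeasure_density) (auto intro!: nn_integral_cong)
    also have "\<dots> \<le> (\<integral>\<^sup>+x. ennreal C \<partial>K)"
      using k by (intro nn_integral_mono ennreal_leI) auto
    also have "\<dots> < \<infinity>"
      using K.emeasure_finite[of "space K"] by (simp add: ennreal_mult_eq_top_iff less_top[symmetric])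
    finally show ?thesis
      by (intro finite_measure.finite_measure_distr finite_measureI) auto
  qed
  have ch: "char (distr (density K (\<lambda>x. ennreal (k x))) borel h) u = (\<integral>x. k x *\<^sub>R iexp (u * h x) \<partial>K)"
    if [measurable]: "k \<in> borel_measurable K" "h \<in> borel_measurable K" and "\<And>x. 0 \<le> k x"
    for K :: "'c measure" and k h :: "'c \<Rightarrow> real" and u
    unfolding char_def using that(3)
    by (subst integral_distr) (auto simp: integral_density)
  have meas: "measure (distr (density K (\<lambda>x. ennreal (k x))) borel h) S
      = (\<integral>x. indicator S (h x) * k x \<partial>K)"
    if [measurable]: "k \<in> borel_measurable K" "h \<in> borel_measurable K" and k: "\<And>x. 0 \<le> k x"
    for K :: "'c measure" and k h :: "'c \<Rightarrow> real"
  proof -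
    have "measure (distr (density K (\<lambda>x. ennreal (k x))) borel h) S
        = (\<integral>x. indicator S x \<partial>distr (density K (\<lambda>x. ennreal (k x))) borel h)"
      by simp
    also have "\<dots> = (\<integral>x. indicator S (h x) * k x \<partial>K)"
      using k by (subst integral_distr) (auto simp: integral_density mult.commute)
    finally show ?thesis .
  qed
  have "distr (density M (\<lambda>x. ennreal (w x))) borel f = distr (density N (\<lambda>x. ennreal (v x))) borel g"
    by (rule finite_measure_eq_of_char_eq)
      (use fin_distr[of M w f] fin_distr[of N v g] fin w v char ch[of w M f] ch[of v N g] in auto)
  then show ?thesis
    using meas[of w M f] meas[of v N g] w v by simp
qed

text \<open>
  Coordinates are removed one at a time. Restricting both measures to \<open>{f s \<in> A s}\<close> must preserve the
  equality of the Fourier transforms in the remaining coordinates; with \<open>y = \<Sum>t\<in>F. \<theta> t * f t\<close>, this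
  amounts to the equality of the integrals of \<open>cos y\<close> and \<open>sin y\<close> over \<open>{f s \<in> A s}\<close>. The weights
  \<open>1 + cos y\<close> and \<open>1 + sin y\<close> are nonnegative, and the Fourier transforms in the variable \<open>f s\<close> of the
  measures with these densities are combinations of the given ones, so one-dimensional uniqueness applies.
\<close>

lemma finite_measure_boxes_eq:
  fixes f :: "'t \<Rightarrow> 'a \<Rightarrow> real" and g :: "'t \<Rightarrow> 'b \<Rightarrow> real"
  assumes "finite F"
    and "finite_measure M" "finite_measure N"
    and "\<And>t. t \<in> F \<Longrightarrow> f t \<in> borel_measurable M" "\<And>t. t \<in> F \<Longrightarrow> g t \<in> borel_measurable N"
    and "\<And>\<theta>. (\<integral>x. iexp (\<Sum>t\<in>F. \<theta> t * f t x) \<partial>M) = (\<integral>x. iexp (\<Sum>t\<in>F. \<theta> t * g t x) \<partial>N)"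
    and "\<And>t. t \<in> F \<Longrightarrow> A t \<in> sets borel"
  shows "measure M {x \<in> space M. \<forall>t\<in>F. f t x \<in> A t} = measure N {x \<in> space N. \<forall>t\<in>F. g t x \<in> A t}"
  using assms
proof (induction F arbitrary: M N rule: finite_induct)
  case empty
  then show ?case by simp
next
  case (insert s F)
  interpret M: finite_measure M by fact
  interpret N: finite_measure N by fact
  note fm[measurable] = insert.prems(3)[OF insertI2] and gm[measurable] = insert.prems(4)[OF insertI2]
  have [measurable]: "f s \<in> borel_measurable M" "g s \<in> borel_measurable N" "A s \<in> sets borel"
    using insert.prems by auto
  have intM: "integrable M (\<lambda>x. iexp (h x))" if [measurable]: "h \<in> borel_measurable M" for h
    by (rule M.integrable_const_bound[where B=1]) auto
  have intN: "integrable N (\<lambda>x. iexp (h x))" if [measurable]: "h \<in> borel_measurable N" for h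
    by (rule N.integrable_const_bound[where B=1]) auto
  define PM where "PM = density M (indicator {x \<in> space M. f s x \<in> A s})"
  define PN where "PN = density N (indicator {x \<in> space N. g s x \<in> A s})"
  have char: "(\<integral>x. iexp (\<Sum>t\<in>F. \<theta> t * f t x) \<partial>PM) = (\<integral>x. iexp (\<Sum>t\<in>F. \<theta> t * g t x) \<partial>PN)" for \<theta>
  proof -
    define y where "y x = (\<Sum>t\<in>F. \<theta> t * f t x)" for x
    define z where "z x = (\<Sum>t\<in>F. \<theta> t * g t x)" for x
    have [measurable]: "y \<in> borel_measurable M" "z \<in> borel_measurable N"
      unfolding y_def z_def by measurable
    \<comment> \<open>Both transforms in all coordinates, at \<open>u\<close> in direction \<open>s\<close> and \<open>k * \<theta>\<close> in the others.\<close>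
    have sh: "(\<integral>x. iexp (u * f s x + k * y x) \<partial>M) = (\<integral>x. iexp (u * g s x + k * z x) \<partial>N)" for u k
    proof -
      have "(\<Sum>t\<in>insert s F. ((\<lambda>t. k * \<theta> t)(s := u)) t * h t) = u * h s + k * (\<Sum>t\<in>F. \<theta> t * h t)"
        for h :: "'t \<Rightarrow> real"
      proof -
        have "(\<Sum>t\<in>F. ((\<lambda>t. k * \<theta> t)(s := u)) t * h t) = (\<Sum>t\<in>F. k * (\<theta> t * h t))"
          using insert.hyps by (intro sum.cong) auto
        then show ?thesis
          using insert.hyps by (simp add: sum_distrib_left)
      qed
      then show ?thesis
        using insert.prems(5)[of "(\<lambda>t. k * \<theta> t)(s := u)"] by (simp add: y_def z_def)
    qed
    have sh0: "(\<integral>x. iexp (u * f s x) \<partial>M) = (\<integral>x. iexp (u * g s x) \<partial>N)" for u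
      using sh[of u 0] by simp
    have shp: "(\<integral>x. iexp (u * f s x + y x) \<partial>M) = (\<integral>x. iexp (u * g s x + z x) \<partial>N)" for u
      using sh[of u 1] by simp
    have shm: "(\<integral>x. iexp (u * f s x - y x) \<partial>M) = (\<integral>x. iexp (u * g s x - z x) \<partial>N)" for u
      using sh[of u "-1"] by simp
    have w0: "(\<integral>x. indicator (A s) (f s x) * (1::real) \<partial>M) = (\<integral>x. indicator (A s) (g s x) * 1 \<partial>N)"
      by (rule weighted_integral_eq_of_char_eq[where C=1])
        (use sh0 in \<open>auto simp: M.finite_measure_axioms N.finite_measure_axioms\<close>)
    have ecos: "(1 + cos b) *\<^sub>R iexp a = iexp a + (iexp (a + b) + iexp (a - b)) / 2" for a b :: real
      by (simp add: complex_eq_iff Re_exp Im_exp cos_add sin_add cos_diff sin_diff algebra_simps)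
    have w1: "(\<integral>x. indicator (A s) (f s x) * (1 + cos (y x)) \<partial>M)
        = (\<integral>x. indicator (A s) (g s x) * (1 + cos (z x)) \<partial>N)"
    proof (rule weighted_integral_eq_of_char_eq[where C=2])
      fix u
      show "(\<integral>x. (1 + cos (y x)) *\<^sub>R iexp (u * f s x) \<partial>M) = (\<integral>x. (1 + cos (z x)) *\<^sub>R iexp (u * g s x) \<partial>N)"
        unfolding ecos using sh0[of u] shp[of u] shm[of u]
        by (simp add: intM intN del: of_real_add of_real_diff of_real_mult)
    next
      have "0 \<le> 1 + cos a" for a :: real
        using cos_ge_minus_one[of a] by linarith
      then show "\<And>x. 0 \<le> 1 + cos (y x)" "\<And>x. 0 \<le> 1 + cos (z x)" by auto
    qed (use M.finite_measure_axioms N.finite_measure_axioms in auto)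
    have esin: "(1 + sin b) *\<^sub>R iexp a = iexp a + (iexp (a + b) - iexp (a - b)) / (2 * \<i>)" for a b :: real
      by (simp add: complex_eq_iff Re_exp Im_exp Re_divide Im_divide cos_add sin_add cos_diff sin_diff algebra_simps)
    have w2: "(\<integral>x. indicator (A s) (f s x) * (1 + sin (y x)) \<partial>M)
        = (\<integral>x. indicator (A s) (g s x) * (1 + sin (z x)) \<partial>N)"
    proof (rule weighted_integral_eq_of_char_eq[where C=2])
      fix u
      show "(\<integral>x. (1 + sin (y x)) *\<^sub>R iexp (u * f s x) \<partial>M) = (\<integral>x. (1 + sin (z x)) *\<^sub>R iexp (u * g s x) \<partial>N)"
        unfolding esin using sh0[of u] shp[of u] shm[of u]
        by (simp add: intM intN del: of_real_add of_real_diff of_real_mult)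
    next
      have "0 \<le> 1 + sin a" for a :: real
        using sin_ge_minus_one[of a] by linarith
      then show "\<And>x. 0 \<le> 1 + sin (y x)" "\<And>x. 0 \<le> 1 + sin (z x)" by auto
    qed (use M.finite_measure_axioms N.finite_measure_axioms in auto)
    have bM: "integrable M (\<lambda>x. indicator (A s) (f s x) * h x)"
      if [measurable]: "h \<in> borel_measurable M" and "\<And>x. \<bar>h x\<bar> \<le> 1" for h :: "'a \<Rightarrow> real"
      by (rule M.integrable_const_bound[where B=1]) (use that in \<open>auto simp: indicator_def\<close>)
    have bN: "integrable N (\<lambda>x. indicator (A s) (g s x) * h x)"
      if [measurable]: "h \<in> borel_measurable N" and "\<And>x. \<bar>h x\<bar> \<le> 1" for h :: "'b \<Rightarrow> real"
      by (rule N.integrable_const_bound[where B=1]) (use that in \<open>auto simp: indicator_def\<close>)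
    have c: "(\<integral>x. indicator (A s) (f s x) * cos (y x) \<partial>M) = (\<integral>x. indicator (A s) (g s x) * cos (z x) \<partial>N)"
      using w0 w1 bM[of "\<lambda>_. 1"] bN[of "\<lambda>_. 1"] by (simp add: distrib_left bM bN)
    have d: "(\<integral>x. indicator (A s) (f s x) * sin (y x) \<partial>M) = (\<integral>x. indicator (A s) (g s x) * sin (z x) \<partial>N)"
      using w0 w2 bM[of "\<lambda>_. 1"] bN[of "\<lambda>_. 1"] by (simp add: distrib_left bM bN)
    have iM: "(\<integral>x. iexp (y x) \<partial>PM) =
        of_real (\<integral>x. indicator (A s) (f s x) * cos (y x) \<partial>M) + \<i> * of_real (\<integral>x. indicator (A s) (f s x) * sin (y x) \<partial>M)"
    proof -
      have "(\<integral>x. iexp (y x) \<partial>PM) = (\<integral>x. (indicator {x \<in> space M. f s x \<in> A s} x :: real) *\<^sub>R iexp (y x) \<partial>M)"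
        unfolding PM_def ennreal_indicator[symmetric] by (subst integral_density) auto
      also have "\<dots> = (\<integral>x. of_real (indicator (A s) (f s x) * cos (y x)) + \<i> * of_real (indicator (A s) (f s x) * sin (y x)) \<partial>M)"
        by (intro Bochner_Integration.integral_cong) (auto simp: indicator_def cis_conv_exp[symmetric] complex_eq_iff)
      finally show ?thesis
        by (simp add: bM del: of_real_mult)
    qed
    have iN: "(\<integral>x. iexp (z x) \<partial>PN) =
        of_real (\<integral>x. indicator (A s) (g s x) * cos (z x) \<partial>N) + \<i> * of_real (\<integral>x. indicator (A s) (g s x) * sin (z x) \<partial>N)"
    proof -
      have "(\<integral>x. iexp (z x) \<partial>PN) = (\<integral>x. (indicator {x \<in> space N. g s x \<in> A s} x :: real) *\<^sub>R iexp (z x) \<partial>N)"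
        unfolding PN_def ennreal_indicator[symmetric] by (subst integral_density) auto
      also have "\<dots> = (\<integral>x. of_real (indicator (A s) (g s x) * cos (z x)) + \<i> * of_real (indicator (A s) (g s x) * sin (z x)) \<partial>N)"
        by (intro Bochner_Integration.integral_cong) (auto simp: indicator_def cis_conv_exp[symmetric] complex_eq_iff)
      finally show ?thesis
        by (simp add: bN del: of_real_mult)
    qed
    show ?thesis
      using iM iN c d by (simp add: y_def z_def)
  qed
  have "finite_measure PM" "finite_measure PN"
    unfolding PM_def PN_def
    by (auto intro!: finite_measureI simp: emeasure_density M.emeasure_eq_measure N.emeasure_eq_measure
        nn_integral_indicator simp flip: indicator_inter_arith)
  then have "measure PM {x \<in> space PM. \<forall>t\<in>F. f t x \<in> A t} = measure PN {x \<in> space PN. \<forall>t\<in>F. g t x \<in> A t}"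
    using insert.IH[of PM PN] char insert.prems(6) by (auto simp: PM_def PN_def)
  moreover have "measure PM {x \<in> space PM. \<forall>t\<in>F. f t x \<in> A t} = measure M {x \<in> space M. \<forall>t\<in>insert s F. f t x \<in> A t}"
  proof -
    have [measurable]: "{x \<in> space M. \<forall>t\<in>F. f t x \<in> A t} \<in> sets M"
      using insert by (intro sets.sets_Collect_finite_All) (auto intro!: measurable_sets_Collect[OF fm])
    show ?thesis
      unfolding PM_def measure_def
      by (subst emeasure_density) (auto simp: indicator_inter_arith[symmetric] intro!: arg_cong[where f="\<lambda>E. enn2real (emeasure M E)"])
  qed
  moreover have "measure PN {x \<in> space PN. \<forall>t\<in>F. g t x \<in> A t} = measure N {x \<in> space N. \<forall>t\<in>insert s F. g t x \<in> A t}"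
  proof -
    have [measurable]: "{x \<in> space N. \<forall>t\<in>F. g t x \<in> A t} \<in> sets N"
      using insert by (intro sets.sets_Collect_finite_All) (auto intro!: measurable_sets_Collect[OF gm])
    show ?thesis
      unfolding PN_def measure_def
      by (subst emeasure_density) (auto simp: indicator_inter_arith[symmetric] intro!: arg_cong[where f="\<lambda>E. enn2real (emeasure N E)"])
  qed
  ultimately show ?case by simp
qed

section \<open>Characteristic functions of Poisson integrals\<close>

lemma trunc_eq_clamp: "trunc u = max (-1) (min 1 u)"
  by (auto simp: trunc_def)

lemma trunc_measurable [measurable]: "trunc \<in> borel_measurable borel"
  unfolding trunc_eq_clamp[abs_def] by measurable

lemma abs_trunc_le_1: "\<bar>trunc u\<bar> \<le> 1"
  by (auto simp: trunc_def)

lemma trunc_0 [simp]: "trunc 0 = 0"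
  by (simp add: trunc_def)

locale poisson_process =
  fixes Q :: "'q measure" and M :: "'a measure" and J :: "'q \<Rightarrow> nat set" and U :: "nat \<Rightarrow> 'q \<Rightarrow> 'a"
  assumes poisson: "poisson_point_process Q M J U"

sublocale poisson_process \<subseteq> prob_space Q
  using poisson by (simp add: poisson_point_process_def)

context poisson_process
begin

abbreviation points_in :: "'a set \<Rightarrow> 'q \<Rightarrow> nat set" where
  "points_in B \<omega> \<equiv> {i \<in> J \<omega>. U i \<omega> \<in> B}"

text \<open>
  If infinitely many points fall into \<open>B\<close>, the sum takes the default value \<open>0\<close>; this happens with
  probability \<open>0\<close> when \<open>B\<close> has finite intensity.
\<close>

definition poisson_sum :: "'a set \<Rightarrow> ('a \<Rightarrow> real) \<Rightarrow> 'q \<Rightarrow> real" where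
  "poisson_sum B g \<omega> = (\<Sum>i\<in>points_in B \<omega>. g (U i \<omega>))"

lemma point_in_space: "\<omega> \<in> space Q \<Longrightarrow> i \<in> J \<omega> \<Longrightarrow> U i \<omega> \<in> space M"
  using poisson by (simp add: poisson_point_process_def)

lemma hit_sets: "B \<in> sets M \<Longrightarrow> {\<omega> \<in> space Q. i \<in> J \<omega> \<and> U i \<omega> \<in> B} \<in> sets Q"
  using poisson by (simp add: poisson_point_process_def)

lemma prob_point_count:
  "B \<in> sets M \<Longrightarrow> emeasure M B < \<infinity> \<Longrightarrow>
    prob {\<omega> \<in> space Q. point_count J U B \<omega> = of_nat k} = measure M B ^ k / fact k * exp (- measure M B)"
  using poisson by (simp add: poisson_point_process_def)

lemma indep_point_count:
  "(\<And>k. k < n \<Longrightarrow> B k \<in> sets M) \<Longrightarrow> disjoint_family_on B {..<n} \<Longrightarrow>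
    indep_vars (\<lambda>_. borel) (\<lambda>k. point_count J U (B k)) {..<n}" for n :: nat
  using poisson by (simp add: poisson_point_process_def)

lemma point_count_measurable [measurable]:
  assumes "B \<in> sets M"
  shows "point_count J U B \<in> borel_measurable Q"
proof -
  have "indep_vars (\<lambda>_. borel) (\<lambda>k. point_count J U B) {..<Suc 0}"
    using assms by (intro indep_point_count) (auto simp: disjoint_family_on_def)
  then show ?thesis
    by (auto simp: indep_vars_def)
qed

lemma point_count_eq:
  "point_count J U B \<omega> = (if finite (points_in B \<omega>) then of_nat (card (points_in B \<omega>)) else \<infinity>)"
  by (simp add: point_count_def)

lemma sums_poisson: "(\<lambda>k. c ^ k / fact k * exp (- c)) sums (1::real)"
proof -
  have "(\<lambda>k. (c ^ k /\<^sub>R fact k) * exp (- c)) sums (exp c * exp (- c))"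
    by (intro sums_mult2 exp_converges)
  then show ?thesis
    by (simp add: exp_minus field_simps)
qed

text \<open>
  The Poisson probabilities of the finite counts already sum to \<open>1\<close>.
\<close>

lemma AE_finite_points_in:
  assumes [measurable]: "B \<in> sets M" and fin: "emeasure M B < \<infinity>"
  shows "AE \<omega> in Q. finite (points_in B \<omega>)"
proof -
  let ?A = "\<lambda>k::nat. {\<omega> \<in> space Q. point_count J U B \<omega> = of_nat k}"
  have "(\<lambda>k. prob (?A k)) sums prob (\<Union>k. ?A k)"
    by (intro finite_measure_UNION) (auto simp: disjoint_family_on_def)
  moreover have "(\<lambda>k. prob (?A k)) sums 1"
    unfolding prob_point_count[OF assms] by (rule sums_poisson)
  ultimately have "prob (\<Union>k. ?A k) = 1"
    by (rule sums_unique2)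
  then have "AE \<omega> in Q. \<omega> \<in> (\<Union>k. ?A k)"
    by (intro AE_prob_1)
  then show ?thesis
    by eventually_elim (auto simp: point_count_eq split: if_splits)
qed

lemma integral_iexp_point_count:
  assumes [measurable]: "B \<in> sets M" and fin: "emeasure M B < \<infinity>"
  shows "(\<integral>\<omega>. iexp (a * enn2real (point_count J U B \<omega>)) \<partial>Q) = exp (measure M B * (iexp a - 1))"
proof -
  define c where "c = measure M B"
  define K where "K \<omega> = nat \<lfloor>enn2real (point_count J U B \<omega>)\<rfloor>" for \<omega>
  have K[measurable]: "K \<in> measurable Q (count_space UNIV)"
    unfolding K_def by measurable
  have real_K: "real (K \<omega>) = enn2real (point_count J U B \<omega>)" for \<omega>
    by (simp add: K_def point_count_eq)
  have distr: "distr Q (count_space UNIV) K = density (count_space UNIV) (\<lambda>k. ennreal (c ^ k / fact k * exp (- c)))"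
  proof (rule measure_eqI_countable[where A=UNIV])
    fix k
    have "AE \<omega> in Q. K \<omega> = k \<longleftrightarrow> point_count J U B \<omega> = of_nat k"
      using AE_finite_points_in[OF assms] by eventually_elim (simp add: K_def point_count_eq)
    then have "prob {\<omega> \<in> space Q. K \<omega> = k} = prob {\<omega> \<in> space Q. point_count J U B \<omega> = of_nat k}"
      by (intro finite_measure_eq_AE) auto
    then have "emeasure Q {\<omega> \<in> space Q. K \<omega> = k} = ennreal (c ^ k / fact k * exp (- c))"
      by (simp add: emeasure_eq_measure prob_point_count[OF assms] c_def)
    moreover have "K -` {k} \<inter> space Q = {\<omega> \<in> space Q. K \<omega> = k}"
      by auto
    ultimately show "emeasure (distr Q (count_space UNIV) K) {k} =
        emeasure (density (count_space UNIV) (\<lambda>k. ennreal (c ^ k / fact k * exp (- c)))) {k}"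
      by (simp add: emeasure_distr emeasure_density nn_integral_count_space_indicator[symmetric]
          nn_integral_count_space_finite)
  qed auto
  have term_eq: "(c ^ k / fact k * exp (- c)) *\<^sub>R iexp (a * real k) = ((of_real c * iexp a) ^ k /\<^sub>R fact k) * exp (- of_real c)" for k
    by (simp add: scaleR_conv_of_real power_mult_distrib exp_of_nat_mult[symmetric] exp_of_real[symmetric] mult_ac divide_simps)
  have sm: "(\<lambda>k. (c ^ k / fact k * exp (- c)) *\<^sub>R iexp (a * real k)) sums (exp (of_real c * iexp a) * exp (- of_real c))"
    unfolding term_eq by (intro sums_mult2 exp_converges)
  have c0: "0 \<le> c" by (simp add: c_def)
  have int: "integrable (count_space UNIV) (\<lambda>k. (c ^ k / fact k * exp (- c)) *\<^sub>R iexp (a * real k))"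
    unfolding integrable_count_space_nat_iff using c0 sums_poisson[of c]
    by (simp add: sums_iff abs_mult)
  have "(\<integral>\<omega>. iexp (a * enn2real (point_count J U B \<omega>)) \<partial>Q) = (\<integral>k. iexp (a * real k) \<partial>distr Q (count_space UNIV) K)"
    by (subst integral_distr) (auto simp: real_K)
  also have "\<dots> = (\<integral>k. (c ^ k / fact k * exp (- c)) *\<^sub>R iexp (a * real k) \<partial>count_space UNIV)"
    unfolding distr using c0 by (subst integral_density) auto
  also have "\<dots> = exp (of_real c * iexp a) * exp (- of_real c)"
    using integral_count_space_nat[OF int] sm by (simp add: sums_iff)
  also have "\<dots> = exp (c * (iexp a - 1))"
    by (simp add: exp_add[symmetric] algebra_simps)
  finally show ?thesis
    by (simp add: c_def)
qed

text \<open>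
  Only events \<open>i \<in> J \<and> U i \<in> B\<close> are known to be measurable, not \<open>U i\<close> itself, so the sum is first
  written as a series of variables that vanish off these events.
\<close>

lemma poisson_sum_measurable [measurable]:
  assumes [measurable]: "B \<in> sets M" "g \<in> borel_measurable M"
  shows "poisson_sum B g \<in> borel_measurable Q"
proof -
  define K where "K i \<omega> = (if i \<in> J \<omega> \<and> U i \<omega> \<in> B then g (U i \<omega>) else 0)" for i \<omega>
  have [measurable]: "K i \<in> borel_measurable Q" for i
  proof (rule measurableI)
    fix S :: "real set" assume [measurable]: "S \<in> sets borel"
    have "K i -` S \<inter> space Q =
        {\<omega> \<in> space Q. i \<in> J \<omega> \<and> U i \<omega> \<in> B \<inter> (g -` S \<inter> space M)} \<union>
        (if 0 \<in> S then space Q - {\<omega> \<in> space Q. i \<in> J \<omega> \<and> U i \<omega> \<in> B} else {})"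
      using sets.sets_into_space[OF assms(1)] by (auto simp: K_def split: if_splits)
    also have "\<dots> \<in> sets Q"
      by (intro sets.Un hit_sets) (auto intro!: hit_sets)
    finally show "K i -` S \<inter> space Q \<in> sets Q" .
  qed simp
  have "poisson_sum B g \<omega> = (if point_count J U B \<omega> = \<infinity> then 0 else \<Sum>i. K i \<omega>)" for \<omega>
  proof (cases "finite (points_in B \<omega>)")
    case True
    then have "(\<Sum>i. K i \<omega>) = (\<Sum>i\<in>points_in B \<omega>. K i \<omega>)"
      by (intro suminf_finite) (auto simp: K_def)
    also have "\<dots> = poisson_sum B g \<omega>"
      by (simp add: poisson_sum_def K_def)
    finally show ?thesis
      using True by (simp add: point_count_eq)
  qed (simp add: poisson_sum_def point_count_eq)
  then have "poisson_sum B g = (\<lambda>\<omega>. if point_count J U B \<omega> = \<infinity> then 0 else \<Sum>i. K i \<omega>)"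
    by auto
  also have "\<dots> \<in> borel_measurable Q"
    by measurable
  finally show ?thesis .
qed

text \<open>
  On the level sets of \<open>g\<close> the counts are independent Poisson variables, and the sum is a linear combination
  of them.
\<close>

lemma integral_iexp_poisson_sum_simple:
  assumes B[measurable]: "B \<in> sets M" and fin: "emeasure M B < \<infinity>" and g: "simple_function M g"
  shows "(\<integral>\<omega>. iexp (poisson_sum B g \<omega>) \<partial>Q) = exp (\<integral>x. indicat_real B x *\<^sub>R (iexp (g x) - 1) \<partial>M)"
proof -
  define V where "V = g ` space M"
  have "finite V"
    using g by (simp add: V_def simple_function_def)
  then obtain v where v: "bij_betw v {..<card V} V"
    using ex_bij_betw_nat_finite by (metis atLeast0LessThan)
  define n where "n = card V"
  define C where "C k = B \<inter> (g -` {v k} \<inter> space M)" for k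
  have [measurable]: "g \<in> borel_measurable M"
    by (rule borel_measurable_simple_function[OF g])
  have [measurable]: "C k \<in> sets M" for k
    unfolding C_def by measurable
  have Cfin: "emeasure M (C k) < \<infinity>" for k
    using emeasure_mono[of "C k" B M] fin by (auto simp: C_def)
  have inj: "v k = v l \<longleftrightarrow> k = l" if "k < n" "l < n" for k l
    using v that by (auto simp: bij_betw_def inj_on_def n_def)
  have disj: "disjoint_family_on C {..<n}"
    by (auto simp: disjoint_family_on_def C_def inj)
  have ex: "\<exists>k<n. g x = v k" if "x \<in> space M" for x
    using v that unfolding bij_betw_def V_def n_def by (metis imageE imageI lessThan_iff)
  have sum_eq: "AE \<omega> in Q. poisson_sum B g \<omega> = (\<Sum>k<n. v k * enn2real (point_count J U (C k) \<omega>))"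
    using AE_finite_points_in[OF B fin] AE_space
  proof eventually_elim
    case (elim \<omega>)
    have fC: "finite (points_in (C k) \<omega>)" for k
      by (rule finite_subset[OF _ elim(1)]) (auto simp: C_def)
    have "points_in B \<omega> = (\<Union>k<n. points_in (C k) \<omega>)"
      using ex point_in_space[OF elim(2)] by (auto simp: C_def)
    then have "poisson_sum B g \<omega> = (\<Sum>i\<in>(\<Union>k<n. points_in (C k) \<omega>). g (U i \<omega>))"
      by (simp add: poisson_sum_def)
    also have "\<dots> = (\<Sum>k<n. \<Sum>i\<in>points_in (C k) \<omega>. g (U i \<omega>))"
      using disj fC by (intro sum.UNION_disjoint) (auto simp: disjoint_family_on_def)
    also have "\<dots> = (\<Sum>k<n. v k * enn2real (point_count J U (C k) \<omega>))"
      using fC by (intro sum.cong) (auto simp: point_count_eq C_def)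
    finally show ?case .
  qed
  have "(\<integral>\<omega>. iexp (poisson_sum B g \<omega>) \<partial>Q) = (\<integral>\<omega>. (\<Prod>k<n. iexp (v k * enn2real (point_count J U (C k) \<omega>))) \<partial>Q)"
    using sum_eq by (intro integral_cong_AE) (auto simp: sum_distrib_left exp_sum)
  also have "\<dots> = (\<Prod>k<n. \<integral>\<omega>. iexp (v k * enn2real (point_count J U (C k) \<omega>)) \<partial>Q)"
  proof (rule indep_vars_lebesgue_integral)
    show "indep_vars (\<lambda>_. borel) (\<lambda>k \<omega>. iexp (v k * enn2real (point_count J U (C k) \<omega>))) {..<n}"
      by (rule indep_vars_compose2[OF indep_point_count[OF _ disj]]) auto
    show "integrable Q (\<lambda>\<omega>. iexp (v k * enn2real (point_count J U (C k) \<omega>)))" for k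
      by (rule integrable_const_bound[where B=1]) auto
  qed simp
  also have "\<dots> = exp (\<Sum>k<n. measure M (C k) * (iexp (v k) - 1))"
    using Cfin by (subst exp_sum) (auto intro!: prod.cong integral_iexp_point_count simp del: of_real_mult)
  also have "(\<Sum>k<n. measure M (C k) * (iexp (v k) - 1)) = (\<integral>x. (\<Sum>k<n. indicat_real (C k) x *\<^sub>R (iexp (v k) - 1)) \<partial>M)"
  proof -
    have "C k \<inter> space M = C k" for k
      by (auto simp: C_def)
    then show ?thesis
      using Cfin by (subst Bochner_Integration.integral_sum) (auto simp: scaleR_conv_of_real intro!: integrable_scaleR_left)
  qed
  also have "\<dots> = (\<integral>x. indicat_real B x *\<^sub>R (iexp (g x) - 1) \<partial>M)"
  proof (intro Bochner_Integration.integral_cong refl)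
    fix x assume x: "x \<in> space M"
    then obtain k where k: "k < n" "g x = v k"
      using ex by blast
    have "(\<Sum>l<n. indicat_real (C l) x *\<^sub>R (iexp (v l) - 1)) = (\<Sum>l\<in>{k}. indicat_real (C l) x *\<^sub>R (iexp (v l) - 1))"
      using k x by (intro sum.mono_neutral_right) (auto simp: C_def inj indicator_def)
    then show "(\<Sum>l<n. indicat_real (C l) x *\<^sub>R (iexp (v l) - 1)) = indicat_real B x *\<^sub>R (iexp (g x) - 1)"
      using k x by (simp add: C_def indicator_def)
  qed
  finally show ?thesis .
qed

text \<open>
  Both sides are continuous under pointwise approximation of \<open>g\<close> by simple functions: the left one since
  almost surely only finitely many points lie in \<open>B\<close>, the right one since \<open>B\<close> has finite measure.
\<close>

lemma integral_iexp_poisson_sum: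
  assumes B[measurable]: "B \<in> sets M" and fin: "emeasure M B < \<infinity>" and g[measurable]: "g \<in> borel_measurable M"
  shows "(\<integral>\<omega>. iexp (poisson_sum B g \<omega>) \<partial>Q) = exp (\<integral>x. indicat_real B x *\<^sub>R (iexp (g x) - 1) \<partial>M)"
proof -
  obtain s where s: "\<And>n. simple_function M (s n)" "\<And>x. x \<in> space M \<Longrightarrow> (\<lambda>n. s n x) \<longlonglongrightarrow> g x"
    using borel_measurable_implies_sequence_metric[OF g] by metis
  have [measurable]: "s n \<in> borel_measurable M" for n
    by (rule borel_measurable_simple_function[OF s(1)])
  have "(\<lambda>n. \<integral>\<omega>. iexp (poisson_sum B (s n) \<omega>) \<partial>Q) \<longlonglongrightarrow> (\<integral>\<omega>. iexp (poisson_sum B g \<omega>) \<partial>Q)"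
  proof (rule integral_dominated_convergence[where w="\<lambda>_. 1"])
    show "AE \<omega> in Q. (\<lambda>n. iexp (poisson_sum B (s n) \<omega>)) \<longlonglongrightarrow> iexp (poisson_sum B g \<omega>)"
      using AE_space
      by eventually_elim (auto simp: poisson_sum_def intro!: tendsto_intros s point_in_space)
  qed auto
  moreover have "(\<lambda>n. \<integral>\<omega>. iexp (poisson_sum B (s n) \<omega>) \<partial>Q) \<longlonglongrightarrow> exp (\<integral>x. indicat_real B x *\<^sub>R (iexp (g x) - 1) \<partial>M)"
    unfolding integral_iexp_poisson_sum_simple[OF B fin s(1)]
  proof (intro tendsto_exp integral_dominated_convergence[where w="\<lambda>x. indicat_real B x *\<^sub>R 2"])
    show "integrable M (\<lambda>x. indicat_real B x *\<^sub>R (2::real))"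
      using fin by (intro integrable_scaleR_left) auto
    show "AE x in M. (\<lambda>n. indicat_real B x *\<^sub>R (iexp (s n x) - 1)) \<longlonglongrightarrow> indicat_real B x *\<^sub>R (iexp (g x) - 1)"
      using AE_space by eventually_elim (auto intro!: tendsto_intros s)
    show "AE x in M. norm (indicat_real B x *\<^sub>R (iexp (s n x) - 1)) \<le> indicat_real B x *\<^sub>R 2" for n
      by (intro AE_I2) (auto simp: indicator_def intro!: order_trans[OF norm_triangle_ineq4])
  qed auto
  ultimately show ?thesis
    by (rule LIMSEQ_unique)
qed

end

section \<open>The L\'evy--Khintchine formula for Poisson integrals\<close>

definition levy_kernel :: "'t set \<Rightarrow> ('t \<Rightarrow> real) \<Rightarrow> ('t \<Rightarrow> real) \<Rightarrow> complex" where
  "levy_kernel F \<theta> v =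
    iexp (\<Sum>t\<in>F. \<theta> t * v t) - 1 - \<i> * of_real (\<Sum>t\<in>F. \<theta> t * trunc (v t))"

text \<open>
  If all coordinates are at most \<open>1\<close> in modulus, the truncation is inactive and the second-order Taylor
  bound applies, followed by the Cauchy--Schwarz inequality; otherwise the trivial bound suffices, as one of the summands on
  the right equals \<open>1\<close>. The explicit dependence on \<open>\<theta>\<close> matters for continuity of the exponent along rays.
\<close>

lemma norm_levy_kernel_le:
  assumes "finite F"
  shows "norm (levy_kernel F \<theta> v) \<le>
    (2 + (\<Sum>t\<in>F. \<bar>\<theta> t\<bar>) + (\<Sum>t\<in>F. \<bar>\<theta> t\<bar>)\<^sup>2) * (\<Sum>t\<in>F. min 1 (\<bar>v t\<bar>\<^sup>2))"
proof -
  define S where "S = (\<Sum>t\<in>F. \<bar>\<theta> t\<bar>)"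
  define m where "m = (\<Sum>t\<in>F. min 1 (\<bar>v t\<bar>\<^sup>2))"
  have S: "0 \<le> S" and m: "0 \<le> m"
    by (simp_all add: S_def m_def sum_nonneg)
  show ?thesis
  proof (cases "\<forall>t\<in>F. \<bar>v t\<bar> \<le> 1")
    case True
    define y where "y = (\<Sum>t\<in>F. \<theta> t * v t)"
    have m_eq: "m = (\<Sum>t\<in>F. (v t)\<^sup>2)"
      using True unfolding m_def by (intro sum.cong) (auto simp: min_absorb2 abs_square_le_1)
    have "levy_kernel F \<theta> v = iexp y - (\<Sum>k\<le>1. (\<i> * y) ^ k / fact k)"
      using True by (simp add: levy_kernel_def y_def trunc_def algebra_simps)
    then have "norm (levy_kernel F \<theta> v) \<le> \<bar>y\<bar>\<^sup>2 / 2"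
      using iexp_approx1[of y 1] by (simp add: numeral_2_eq_2)
    also have "\<dots> \<le> y\<^sup>2"
      by simp
    also have "\<dots> \<le> (\<Sum>t\<in>F. (\<theta> t)\<^sup>2) * m"
      unfolding y_def m_eq by (rule Cauchy_Schwarz_ineq_sum)
    also have "(\<Sum>t\<in>F. (\<theta> t)\<^sup>2) \<le> S\<^sup>2"
    proof -
      have "(\<Sum>t\<in>F. \<bar>\<theta> t\<bar> * \<bar>\<theta> t\<bar>) \<le> (\<Sum>t\<in>F. \<bar>\<theta> t\<bar> * S)"
        using assms unfolding S_def
        by (intro sum_mono mult_left_mono member_le_sum) auto
      then show ?thesis
        by (simp add: sum_distrib_right[symmetric] S_def power2_eq_square)
    qed
    also have "S\<^sup>2 * m \<le> (2 + S + S\<^sup>2) * m"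
      using S m by (intro mult_right_mono) auto
    finally show ?thesis
      using m by (simp add: S_def m_def mult_right_mono)
  next
    case False
    then obtain t where t: "t \<in> F" "\<bar>v t\<bar> > 1"
      by auto
    have "1 \<le> \<bar>v t\<bar>\<^sup>2"
      using t power_mono[of 1 "\<bar>v t\<bar>" 2] by simp
    then have "1 = min 1 (\<bar>v t\<bar>\<^sup>2)"
      by linarith
    also have "\<dots> \<le> m"
      unfolding m_def using assms t by (intro member_le_sum) auto
    finally have "1 \<le> m" .
    have "\<bar>\<Sum>t\<in>F. \<theta> t * trunc (v t)\<bar> \<le> S"
      unfolding S_def
      by (intro order_trans[OF sum_abs] sum_mono) (auto simp: abs_mult abs_trunc_le_1 mult_left_le)
    moreover have "norm (levy_kernel F \<theta> v) \<le> norm (iexp (\<Sum>t\<in>F. \<theta> t * v t)) + 1 + \<bar>\<Sum>t\<in>F. \<theta> t * trunc (v t)\<bar>"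
      unfolding levy_kernel_def
      by (intro order_trans[OF norm_triangle_ineq4] add_mono) (auto simp: norm_mult simp del: of_real_sum)
    ultimately have "norm (levy_kernel F \<theta> v) \<le> 2 + S"
      by simp
    also have "\<dots> \<le> (2 + S + S\<^sup>2) * 1"
      by simp
    also have "\<dots> \<le> (2 + S + S\<^sup>2) * m"
      using \<open>1 \<le> m\<close> S by (intro mult_left_mono) auto
    finally show ?thesis
      by (simp add: S_def m_def)
  qed
qed

lemma levy_kernel_measurable [measurable]:
  assumes "\<And>t. t \<in> F \<Longrightarrow> f t \<in> borel_measurable M"
  shows "(\<lambda>x. levy_kernel F \<theta> (\<lambda>t. f t x)) \<in> borel_measurable M"
proof -
  have [measurable]: "(\<lambda>x. \<Sum>t\<in>F. \<theta> t * f t x) \<in> borel_measurable M" "(\<lambda>x. \<Sum>t\<in>F. \<theta> t * trunc (f t x)) \<in> borel_measurable M"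
    using assms by (auto intro!: borel_measurable_sum borel_measurable_times measurable_compose[OF _ trunc_measurable])
  show ?thesis
    unfolding levy_kernel_def by measurable
qed

lemma L_plus_measurable: "f \<in> L_plus M \<Longrightarrow> f \<in> borel_measurable M"
  and L_plus_integrable: "f \<in> L_plus M \<Longrightarrow> integrable M (\<lambda>x. min 1 (\<bar>f x\<bar>\<^sup>2))"
  by (simp_all add: L_plus_def)

lemma integrable_levy_kernel:
  assumes "finite F" and f: "\<And>t. t \<in> F \<Longrightarrow> f t \<in> L_plus M"
  shows "integrable M (\<lambda>x. levy_kernel F \<theta> (\<lambda>t. f t x))"
proof (rule Bochner_Integration.integrable_bound)
  show "integrable M (\<lambda>x. (2 + (\<Sum>t\<in>F. \<bar>\<theta> t\<bar>) + (\<Sum>t\<in>F. \<bar>\<theta> t\<bar>)\<^sup>2) * (\<Sum>t\<in>F. min 1 (\<bar>f t x\<bar>\<^sup>2)))"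
    using f by (intro integrable_mult_right Bochner_Integration.integrable_sum L_plus_integrable)
  show "(\<lambda>x. levy_kernel F \<theta> (\<lambda>t. f t x)) \<in> borel_measurable M"
    using f by (intro levy_kernel_measurable L_plus_measurable)
  show "AE x in M. norm (levy_kernel F \<theta> (\<lambda>t. f t x)) \<le>
      norm ((2 + (\<Sum>t\<in>F. \<bar>\<theta> t\<bar>) + (\<Sum>t\<in>F. \<bar>\<theta> t\<bar>)\<^sup>2) * (\<Sum>t\<in>F. min 1 (\<bar>f t x\<bar>\<^sup>2)))"
    by (intro AE_I2 order_trans[OF norm_levy_kernel_le[OF assms(1)]]) simp
qed

lemma L_plus_superlevel_finite:
  assumes f: "f \<in> L_plus M" and "0 < \<epsilon>"
  shows "emeasure M {x \<in> space M. \<bar>f x\<bar> > \<epsilon>} < \<infinity>"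
proof -
  have [measurable]: "f \<in> borel_measurable M"
    by (rule L_plus_measurable[OF f])
  have "integrable M (\<lambda>x. indicat_real {x \<in> space M. \<bar>f x\<bar> > \<epsilon>} x)"
  proof (rule Bochner_Integration.integrable_bound)
    show "integrable M (\<lambda>x. min 1 (\<bar>f x\<bar>\<^sup>2) / min 1 (\<epsilon>\<^sup>2))"
      by (intro integrable_divide L_plus_integrable f)
    have "min 1 (\<epsilon>\<^sup>2) \<le> min 1 (\<bar>f x\<bar>\<^sup>2)" if "\<bar>f x\<bar> > \<epsilon>" for x
      using that \<open>0 < \<epsilon>\<close> power_mono[of \<epsilon> "\<bar>f x\<bar>" 2] by (intro min.mono) auto
    moreover have "0 < min 1 (\<epsilon>\<^sup>2)"
      using \<open>0 < \<epsilon>\<close> by simp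
    ultimately show "AE x in M. norm (indicat_real {x \<in> space M. \<bar>f x\<bar> > \<epsilon>} x) \<le> norm (min 1 (\<bar>f x\<bar>\<^sup>2) / min 1 (\<epsilon>\<^sup>2))"
      by (intro AE_I2) (auto simp: indicator_def le_divide_eq abs_of_pos)
  qed measurable
  then show ?thesis
    by (simp add: integrable_indicator_iff)
qed

context poisson_process
begin

text \<open>
  Along \<open>\<epsilon> n = 1 / (n + 1)\<close> the approximants of all the \<open>I t\<close> are one compensated Poisson sum over the
  set \<open>B n\<close> where some \<open>f t\<close> exceeds \<open>\<epsilon> n\<close>, of the function \<open>g n = \<Sum>t\<in>F. \<theta> t * v n t\<close>, where \<open>v n t\<close> is
  \<open>f t\<close> cut off at level \<open>\<epsilon> n\<close>. Its characteristic function is the exponential of the integral of the kernel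
  at \<open>v n\<close>, and since \<open>\<bar>v n t\<bar> \<le> \<bar>f t\<bar>\<close> the kernels are dominated uniformly in \<open>n\<close>.
\<close>

lemma integral_iexp_poisson_integrals:
  assumes F: "finite F" and f: "\<And>t. t \<in> F \<Longrightarrow> f t \<in> L_plus M"
    and I: "\<And>t. t \<in> F \<Longrightarrow> is_poisson_integral Q M J U (f t) (I t)"
  shows "(\<integral>\<omega>. iexp (\<Sum>t\<in>F. \<theta> t * I t \<omega>) \<partial>Q) = exp (\<integral>x. levy_kernel F \<theta> (\<lambda>t. f t x) \<partial>M)"
proof -
  define \<epsilon> where "\<epsilon> n = inverse (real (Suc n))" for n
  have \<epsilon>: "0 < \<epsilon> n" for n
    by (simp add: \<epsilon>_def)
  have \<epsilon>_lim: "filterlim \<epsilon> (at_right 0) sequentially"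
    unfolding \<epsilon>_def[abs_def]
    by (intro tendsto_imp_filterlim_at_right LIMSEQ_inverse_real_of_nat) auto
  have fm[measurable]: "f t \<in> borel_measurable M" if "t \<in> F" for t
    using L_plus_measurable[OF f[OF that]] .
  have Im[measurable]: "I t \<in> borel_measurable Q" if "t \<in> F" for t
    using I[OF that] by (simp add: is_poisson_integral_def)
  define v where "v n t x = (if \<bar>f t x\<bar> > \<epsilon> n then f t x else 0)" for n t x
  define B where "B n = (\<Union>t\<in>F. {x \<in> space M. \<bar>f t x\<bar> > \<epsilon> n})" for n
  define g where "g n x = (\<Sum>t\<in>F. \<theta> t * v n t x)" for n x
  define a where "a n t = (LINT x:{x \<in> space M. \<bar>f t x\<bar> > \<epsilon> n}|M. trunc (f t x))" for n t
  define c where "c n = (\<Sum>t\<in>F. \<theta> t * a n t)" for n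
  have level[measurable]: "{x \<in> space M. \<bar>f t x\<bar> > \<epsilon> n} \<in> sets M" if "t \<in> F" for n t
    using fm[OF that] by measurable
  have level_fin: "emeasure M {x \<in> space M. \<bar>f t x\<bar> > \<epsilon> n} < \<infinity>" if "t \<in> F" for n t
    using L_plus_superlevel_finite[OF f[OF that] \<epsilon>] .
  have B[measurable]: "B n \<in> sets M" for n
    unfolding B_def using F level by (intro sets.finite_UN) auto
  have B_fin: "emeasure M (B n) < \<infinity>" for n
  proof -
    have "emeasure M (B n) \<le> (\<Sum>t\<in>F. emeasure M {x \<in> space M. \<bar>f t x\<bar> > \<epsilon> n})"
      unfolding B_def using F level by (intro emeasure_subadditive_finite) auto
    also have "\<dots> < \<infinity>"
      using F level_fin by (simp add: less_top)
    finally show ?thesis .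
  qed
  have vm[measurable]: "v n t \<in> borel_measurable M" if "t \<in> F" for n t
    unfolding v_def using fm[OF that] by measurable
  have [measurable]: "g n \<in> borel_measurable M" for n
    unfolding g_def using vm by (auto intro!: borel_measurable_sum)
  have v_min: "min 1 (\<bar>v n t x\<bar>\<^sup>2) \<le> min 1 (\<bar>f t x\<bar>\<^sup>2)" for n t x
    by (simp add: v_def)
  have v_L: "v n t \<in> L_plus M" if "t \<in> F" for n t
    unfolding L_plus_def using vm[OF that] v_min
    by (auto intro!: Bochner_Integration.integrable_bound[OF L_plus_integrable[OF f[OF that]]])
  have v_lim: "(\<lambda>n. v n t x) \<longlonglongrightarrow> f t x" for t x
  proof (cases "f t x = 0")
    case False
    then have "\<forall>\<^sub>F n in sequentially. \<epsilon> n < \<bar>f t x\<bar>"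
      unfolding \<epsilon>_def by (intro order_tendstoD(2)[OF LIMSEQ_inverse_real_of_nat]) simp
    then have "\<forall>\<^sub>F n in sequentially. v n t x = f t x"
      by eventually_elim (simp add: v_def)
    then show ?thesis
      by (rule tendsto_eventually)
  next
    case True
    then have "v n t x = 0" for n
      by (auto simp: v_def)
    then show ?thesis
      using True by simp
  qed

  have sum_eq: "poisson_sum (B n) (g n) \<omega> - c n =
      (\<Sum>t\<in>F. \<theta> t * ((\<Sum>i | i \<in> J \<omega> \<and> \<bar>f t (U i \<omega>)\<bar> > \<epsilon> n. f t (U i \<omega>)) - a n t))"
    if fin: "finite (points_in (B n) \<omega>)" and \<omega>: "\<omega> \<in> space Q" for n \<omega>
  proof -
    have "(\<Sum>i\<in>points_in (B n) \<omega>. v n t (U i \<omega>)) = (\<Sum>i | i \<in> J \<omega> \<and> \<bar>f t (U i \<omega>)\<bar> > \<epsilon> n. f t (U i \<omega>))"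
      if "t \<in> F" for t
      using that fin point_in_space[OF \<omega>]
      by (intro sum.mono_neutral_cong_right) (auto simp: v_def B_def)
    moreover have "poisson_sum (B n) (g n) \<omega> = (\<Sum>t\<in>F. \<theta> t * (\<Sum>i\<in>points_in (B n) \<omega>. v n t (U i \<omega>)))"
      unfolding poisson_sum_def g_def by (subst sum.swap) (simp add: sum_distrib_left)
    ultimately show ?thesis
      by (simp add: c_def sum_subtractf right_diff_distrib)
  qed
  have lim: "AE \<omega> in Q. (\<lambda>n. poisson_sum (B n) (g n) \<omega> - c n) \<longlonglongrightarrow> (\<Sum>t\<in>F. \<theta> t * I t \<omega>)"
  proof -
    have "AE \<omega> in Q. \<forall>n. finite (points_in (B n) \<omega>)"
      unfolding AE_all_countable using AE_finite_points_in[OF B B_fin] by auto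
    moreover have "AE \<omega> in Q. \<forall>t\<in>F.
        ((\<lambda>\<epsilon>. (\<Sum>i | i \<in> J \<omega> \<and> \<bar>f t (U i \<omega>)\<bar> > \<epsilon>. f t (U i \<omega>))
            - (LINT x:{x \<in> space M. \<bar>f t x\<bar> > \<epsilon>}|M. trunc (f t x))) \<longlongrightarrow> I t \<omega>) (at_right 0)"
      using F I by (intro AE_finite_allI) (auto simp: is_poisson_integral_def)
    ultimately show ?thesis
      using AE_space
    proof eventually_elim
      case (elim \<omega>)
      have "(\<lambda>n. (\<Sum>i | i \<in> J \<omega> \<and> \<bar>f t (U i \<omega>)\<bar> > \<epsilon> n. f t (U i \<omega>)) - a n t) \<longlonglongrightarrow> I t \<omega>" if "t \<in> F" for t
        unfolding a_def using filterlim_compose[OF elim(2)[rule_format, OF that] \<epsilon>_lim] .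
      then have "(\<lambda>n. \<Sum>t\<in>F. \<theta> t * ((\<Sum>i | i \<in> J \<omega> \<and> \<bar>f t (U i \<omega>)\<bar> > \<epsilon> n. f t (U i \<omega>)) - a n t)) \<longlonglongrightarrow> (\<Sum>t\<in>F. \<theta> t * I t \<omega>)"
        by (intro tendsto_sum tendsto_mult_left) auto
      then show ?case
        using sum_eq elim by simp
    qed
  qed
  have [measurable]: "(\<lambda>\<omega>. \<Sum>t\<in>F. \<theta> t * I t \<omega>) \<in> borel_measurable Q"
    using Im by (auto intro!: borel_measurable_sum)
  have "(\<lambda>n. \<integral>\<omega>. iexp (poisson_sum (B n) (g n) \<omega> - c n) \<partial>Q) \<longlonglongrightarrow> (\<integral>\<omega>. iexp (\<Sum>t\<in>F. \<theta> t * I t \<omega>) \<partial>Q)"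
  proof (rule integral_dominated_convergence[where w="\<lambda>_. 1"])
    show "AE \<omega> in Q. (\<lambda>n. iexp (poisson_sum (B n) (g n) \<omega> - c n)) \<longlonglongrightarrow> iexp (\<Sum>t\<in>F. \<theta> t * I t \<omega>)"
      using lim by eventually_elim (intro tendsto_intros)
  qed auto
  moreover have "(\<integral>\<omega>. iexp (poisson_sum (B n) (g n) \<omega> - c n) \<partial>Q) = exp (\<integral>x. levy_kernel F \<theta> (\<lambda>t. v n t x) \<partial>M)" for n
  proof -
    have int1: "integrable M (\<lambda>x. indicat_real (B n) x *\<^sub>R (iexp (g n x) - 1))"
    proof (rule Bochner_Integration.integrable_bound)
      show "integrable M (\<lambda>x. indicat_real (B n) x *\<^sub>R (2::real))"
        using B_fin by (intro integrable_scaleR_left) auto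
      show "AE x in M. norm (indicat_real (B n) x *\<^sub>R (iexp (g n x) - 1)) \<le> norm (indicat_real (B n) x *\<^sub>R (2::real))"
        by (intro AE_I2) (auto simp: indicator_def intro!: order_trans[OF norm_triangle_ineq4])
    qed auto
    have int2: "integrable M (\<lambda>x. indicat_real {x \<in> space M. \<bar>f t x\<bar> > \<epsilon> n} x *\<^sub>R trunc (f t x))" if t: "t \<in> F" for t
    proof (rule Bochner_Integration.integrable_bound)
      show "integrable M (\<lambda>x. indicat_real {x \<in> space M. \<bar>f t x\<bar> > \<epsilon> n} x)"
        using level_fin[OF t] level[OF t] by simp
      show "(\<lambda>x. indicat_real {x \<in> space M. \<bar>f t x\<bar> > \<epsilon> n} x *\<^sub>R trunc (f t x)) \<in> borel_measurable M"
        using fm[OF t] by measurable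
    qed (auto simp: indicator_def abs_trunc_le_1)
    have c_eq: "c n = (\<integral>x. (\<Sum>t\<in>F. \<theta> t * (indicat_real {x \<in> space M. \<bar>f t x\<bar> > \<epsilon> n} x *\<^sub>R trunc (f t x))) \<partial>M)"
      unfolding c_def a_def set_lebesgue_integral_def using int2
      by (subst Bochner_Integration.integral_sum) auto
    have int3: "integrable M (\<lambda>x. \<Sum>t\<in>F. \<theta> t * (indicat_real {x \<in> space M. \<bar>f t x\<bar> > \<epsilon> n} x *\<^sub>R trunc (f t x)))"
      using int2 by (intro Bochner_Integration.integrable_sum) auto
    have "(\<integral>\<omega>. iexp (poisson_sum (B n) (g n) \<omega> - c n) \<partial>Q) = (\<integral>\<omega>. iexp (poisson_sum (B n) (g n) \<omega>) * iexp (- c n) \<partial>Q)"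
      by (simp add: exp_add[symmetric] algebra_simps)
    also have "\<dots> = exp (\<integral>x. indicat_real (B n) x *\<^sub>R (iexp (g n x) - 1) \<partial>M) * iexp (- c n)"
      using integral_iexp_poisson_sum[OF B B_fin, of "g n" n] by simp
    also have "\<dots> = exp ((\<integral>x. indicat_real (B n) x *\<^sub>R (iexp (g n x) - 1) \<partial>M) - \<i> * of_real (c n))"
      by (simp add: exp_diff exp_minus divide_inverse)
    also have "(\<integral>x. indicat_real (B n) x *\<^sub>R (iexp (g n x) - 1) \<partial>M) - \<i> * of_real (c n) =
        (\<integral>x. indicat_real (B n) x *\<^sub>R (iexp (g n x) - 1)
          - \<i> * of_real (\<Sum>t\<in>F. \<theta> t * (indicat_real {x \<in> space M. \<bar>f t x\<bar> > \<epsilon> n} x *\<^sub>R trunc (f t x))) \<partial>M)"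
      unfolding c_eq using int1 int3
      by (subst Bochner_Integration.integral_diff) (auto simp del: of_real_sum of_real_mult intro!: integrable_mult_right integrable_of_real)
    also have "\<dots> = (\<integral>x. levy_kernel F \<theta> (\<lambda>t. v n t x) \<partial>M)"
    proof (intro Bochner_Integration.integral_cong refl)
      fix x assume x: "x \<in> space M"
      have "g n x = 0" if "x \<notin> B n"
        using that x unfolding g_def by (intro sum.neutral) (auto simp: B_def v_def)
      then have "indicat_real (B n) x *\<^sub>R (iexp (g n x) - 1) = iexp (g n x) - 1"
        by (auto simp: indicator_def)
      moreover have "(\<Sum>t\<in>F. \<theta> t * (indicat_real {x \<in> space M. \<bar>f t x\<bar> > \<epsilon> n} x *\<^sub>R trunc (f t x))) = (\<Sum>t\<in>F. \<theta> t * trunc (v n t x))"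
        using x by (intro sum.cong) (auto simp: v_def)
      ultimately show "indicat_real (B n) x *\<^sub>R (iexp (g n x) - 1)
          - \<i> * of_real (\<Sum>t\<in>F. \<theta> t * (indicat_real {x \<in> space M. \<bar>f t x\<bar> > \<epsilon> n} x *\<^sub>R trunc (f t x))) = levy_kernel F \<theta> (\<lambda>t. v n t x)"
        by (simp only: levy_kernel_def g_def)
    qed
    finally show ?thesis .
  qed
  moreover have "(\<lambda>n. exp (\<integral>x. levy_kernel F \<theta> (\<lambda>t. v n t x) \<partial>M)) \<longlonglongrightarrow> exp (\<integral>x. levy_kernel F \<theta> (\<lambda>t. f t x) \<partial>M)"
  proof (intro tendsto_exp integral_dominated_convergence)
    show "integrable M (\<lambda>x. (2 + (\<Sum>t\<in>F. \<bar>\<theta> t\<bar>) + (\<Sum>t\<in>F. \<bar>\<theta> t\<bar>)\<^sup>2) * (\<Sum>t\<in>F. min 1 (\<bar>f t x\<bar>\<^sup>2)))"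
      using f by (intro integrable_mult_right Bochner_Integration.integrable_sum L_plus_integrable)
    show "AE x in M. norm (levy_kernel F \<theta> (\<lambda>t. v n t x)) \<le>
        (2 + (\<Sum>t\<in>F. \<bar>\<theta> t\<bar>) + (\<Sum>t\<in>F. \<bar>\<theta> t\<bar>)\<^sup>2) * (\<Sum>t\<in>F. min 1 (\<bar>f t x\<bar>\<^sup>2))" for n
      using v_min by (intro AE_I2 order_trans[OF norm_levy_kernel_le[OF F]] mult_left_mono sum_mono) (auto intro!: add_nonneg_nonneg sum_nonneg)
    show "AE x in M. (\<lambda>n. levy_kernel F \<theta> (\<lambda>t. v n t x)) \<longlonglongrightarrow> levy_kernel F \<theta> (\<lambda>t. f t x)"
      unfolding levy_kernel_def trunc_eq_clamp
      by (intro AE_I2 tendsto_intros v_lim)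
  qed (auto intro!: levy_kernel_measurable fm vm)
  ultimately show ?thesis
    by (metis (no_types, lifting) LIMSEQ_unique ext)
qed

end

section \<open>Uniqueness of the L\'evy measure\<close>

text \<open>
  The values lie in the discrete set of integer multiples of \<open>2 \<pi> i\<close>.
\<close>

lemma continuous_exp_eq_1_imp_const:
  fixes D :: "real \<Rightarrow> complex"
  assumes cont: "continuous_on UNIV D" and D: "\<And>s. exp (D s) = 1"
  shows "D s = D 0"
proof -
  have "D constant_on UNIV"
  proof (rule continuous_discrete_range_constant[OF connected_UNIV cont])
    fix x
    have "2 * pi \<le> norm (D y - D x)" if "D y \<noteq> D x" for y
    proof -
      have re: "Re (D y) = 0" "Re (D x) = 0"
        using D exp_eq_1 by blast+
      obtain n m :: int where nm: "Im (D y) = of_int (2 * n) * pi" "Im (D x) = of_int (2 * m) * pi"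
        using D exp_eq_1 by metis
      have "n \<noteq> m"
        using that re nm by (auto simp: complex_eq_iff)
      then have "1 \<le> \<bar>real_of_int (n - m)\<bar>"
        by linarith
      then have "2 * pi * 1 \<le> 2 * pi * \<bar>real_of_int (n - m)\<bar>"
        by (intro mult_left_mono) auto
      also have "\<dots> = \<bar>Im (D y - D x)\<bar>"
      proof -
        have "Im (D y - D x) = 2 * pi * real_of_int (n - m)"
          using nm by (simp add: algebra_simps)
        then show ?thesis
          by (simp add: abs_mult)
      qed
      also have "\<dots> \<le> norm (D y - D x)"
        by (rule abs_Im_le_cmod)
      finally show ?thesis by simp
    qed
    then show "\<exists>e>0. \<forall>y. y \<in> UNIV \<and> D y \<noteq> D x \<longrightarrow> e \<le> norm (D y - D x)"
      by (intro exI[of _ "2 * pi"]) auto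
  qed
  then show ?thesis
    by (auto simp: constant_on_def)
qed

text \<open>
  The logarithm, continuous along rays, of the characteristic function of \<open>(I(f t) + c t)\<^sub>t\<^sub>\<in>\<^sub>F\<close>.
\<close>

definition levy_exponent ::
  "'a measure \<Rightarrow> ('t \<Rightarrow> 'a \<Rightarrow> real) \<Rightarrow> ('t \<Rightarrow> real) \<Rightarrow> 't set \<Rightarrow> ('t \<Rightarrow> real) \<Rightarrow> complex" where
  "levy_exponent M f c F \<theta> =
    \<i> * of_real (\<Sum>t\<in>F. \<theta> t * c t) + (\<integral>x. levy_kernel F \<theta> (\<lambda>t. f t x) \<partial>M)"

lemma continuous_levy_exponent:
  assumes F: "finite F" and f: "\<And>t. t \<in> F \<Longrightarrow> f t \<in> L_plus M"
  shows "continuous_on UNIV (\<lambda>s. levy_exponent M f c F (\<lambda>t. s * \<theta> t))"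
proof -
  have "isCont (\<lambda>s. \<integral>x. levy_kernel F (\<lambda>t. s * \<theta> t) (\<lambda>t. f t x) \<partial>M) s" for s
  proof (rule continuous_at_sequentiallyI)
    fix u :: "nat \<Rightarrow> real" assume u: "u \<longlonglongrightarrow> s"
    then have "Bseq u"
      by (simp add: convergentI convergent_imp_Bseq)
    then obtain K where K: "0 < K" "\<And>n. \<bar>u n\<bar> \<le> K"
      by (auto elim: BseqE)
    define S where "S = (\<Sum>t\<in>F. \<bar>\<theta> t\<bar>)"
    have S: "0 \<le> S"
      by (simp add: S_def sum_nonneg)
    show "(\<lambda>n. \<integral>x. levy_kernel F (\<lambda>t. u n * \<theta> t) (\<lambda>t. f t x) \<partial>M) \<longlonglongrightarrow>
        (\<integral>x. levy_kernel F (\<lambda>t. s * \<theta> t) (\<lambda>t. f t x) \<partial>M)"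
    proof (rule integral_dominated_convergence)
      show "integrable M (\<lambda>x. (2 + K * S + (K * S)\<^sup>2) * (\<Sum>t\<in>F. min 1 (\<bar>f t x\<bar>\<^sup>2)))"
        using f by (intro integrable_mult_right Bochner_Integration.integrable_sum L_plus_integrable)
      show "AE x in M. norm (levy_kernel F (\<lambda>t. u n * \<theta> t) (\<lambda>t. f t x)) \<le>
          (2 + K * S + (K * S)\<^sup>2) * (\<Sum>t\<in>F. min 1 (\<bar>f t x\<bar>\<^sup>2))" for n
      proof (intro AE_I2 order_trans[OF norm_levy_kernel_le[OF F]] mult_right_mono)
        have eq: "(\<Sum>t\<in>F. \<bar>u n * \<theta> t\<bar>) = \<bar>u n\<bar> * S"
          by (simp add: S_def sum_distrib_left abs_mult)
        have "\<bar>u n\<bar> * S \<le> K * S"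
          using K S by (intro mult_right_mono) auto
        then show "2 + (\<Sum>t\<in>F. \<bar>u n * \<theta> t\<bar>) + (\<Sum>t\<in>F. \<bar>u n * \<theta> t\<bar>)\<^sup>2 \<le> 2 + K * S + (K * S)\<^sup>2"
          unfolding eq using S by (intro add_mono power_mono) auto
      qed (auto intro!: sum_nonneg)
      show "AE x in M. (\<lambda>n. levy_kernel F (\<lambda>t. u n * \<theta> t) (\<lambda>t. f t x)) \<longlonglongrightarrow> levy_kernel F (\<lambda>t. s * \<theta> t) (\<lambda>t. f t x)"
        unfolding levy_kernel_def by (intro AE_I2 tendsto_intros u)
    qed (auto intro!: levy_kernel_measurable L_plus_measurable f)
  qed
  then have "continuous_on UNIV (\<lambda>s. \<integral>x. levy_kernel F (\<lambda>t. s * \<theta> t) (\<lambda>t. f t x) \<partial>M)"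
    by (simp add: continuous_at_imp_continuous_on)
  then show ?thesis
    unfolding levy_exponent_def by (intro continuous_intros)
qed

text \<open>
  Along each ray the difference of the two exponents is a continuous logarithm of \<open>1\<close> that starts at \<open>0\<close>.
\<close>

lemma levy_exponent_unique:
  assumes F: "finite F"
    and f1: "\<And>t. t \<in> F \<Longrightarrow> f1 t \<in> L_plus M1" and f2: "\<And>t. t \<in> F \<Longrightarrow> f2 t \<in> L_plus M2"
    and eq: "\<And>\<theta>. exp (levy_exponent M1 f1 c1 F \<theta>) = exp (levy_exponent M2 f2 c2 F \<theta>)"
  shows "levy_exponent M1 f1 c1 F \<theta> = levy_exponent M2 f2 c2 F \<theta>"
proof -
  define D where "D s = levy_exponent M1 f1 c1 F (\<lambda>t. s * \<theta> t) - levy_exponent M2 f2 c2 F (\<lambda>t. s * \<theta> t)" for s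
  have "continuous_on UNIV D"
    unfolding D_def by (intro continuous_on_diff continuous_levy_exponent F f1 f2)
  moreover have "exp (D s) = 1" for s
    by (simp add: D_def exp_diff eq)
  ultimately have "D 1 = D 0"
    by (rule continuous_exp_eq_1_imp_const)
  also have "D 0 = 0"
    by (simp add: D_def levy_exponent_def levy_kernel_def)
  finally show ?thesis
    by (simp add: D_def)
qed

text \<open>
  The linear compensator cancels in a second difference, which leaves a Fourier kernel with the nonnegative weight
  \<open>1 - cos\<close>.
\<close>

lemma levy_kernel_second_difference:
  "levy_kernel F \<theta> v -
      (levy_kernel F (\<lambda>t. \<theta> t + \<eta> t) v + levy_kernel F (\<lambda>t. \<theta> t - \<eta> t) v) / 2 =
    (1 - cos (\<Sum>t\<in>F. \<eta> t * v t)) *\<^sub>R iexp (\<Sum>t\<in>F. \<theta> t * v t)"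
proof -
  define a where "a = (\<Sum>t\<in>F. \<theta> t * v t)"
  define b where "b = (\<Sum>t\<in>F. \<eta> t * v t)"
  define p where "p = (\<Sum>t\<in>F. \<theta> t * trunc (v t))"
  define q where "q = (\<Sum>t\<in>F. \<eta> t * trunc (v t))"
  have eqs: "levy_kernel F \<theta> v = iexp a - 1 - \<i> * of_real p"
    "levy_kernel F (\<lambda>t. \<theta> t + \<eta> t) v = iexp (a + b) - 1 - \<i> * of_real (p + q)"
    "levy_kernel F (\<lambda>t. \<theta> t - \<eta> t) v = iexp (a - b) - 1 - \<i> * of_real (p - q)"
    by (simp_all add: levy_kernel_def a_def b_def p_def q_def distrib_right left_diff_distrib sum.distrib sum_subtractf)
  show ?thesis
    unfolding eqs a_def[symmetric] b_def[symmetric]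
    by (simp add: complex_eq_iff Re_exp Im_exp cos_add sin_add cos_diff sin_diff field_simps)
qed

text \<open>
  The weight is minus the real part of a one-dimensional kernel.
\<close>

lemma cos_weight_integrable:
  assumes "f \<in> L_plus M"
  shows "integrable M (\<lambda>x. 1 - cos (h * f x))"
proof -
  have "integrable M (\<lambda>x. - Re (levy_kernel {()} (\<lambda>_. h) (\<lambda>_. f x)))"
    using assms by (intro integrable_minus integrable_Re integrable_levy_kernel) auto
  then show ?thesis
    by (simp add: levy_kernel_def Re_exp)
qed

lemma cos_weighted_char_eq:
  fixes f1 :: "'t \<Rightarrow> 'a \<Rightarrow> real" and f2 :: "'t \<Rightarrow> 'b \<Rightarrow> real"
  assumes F: "finite F" and s: "s \<in> F"
    and f1: "\<And>t. t \<in> F \<Longrightarrow> f1 t \<in> L_plus M1" and f2: "\<And>t. t \<in> F \<Longrightarrow> f2 t \<in> L_plus M2"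
    and eq: "\<And>\<theta>. levy_exponent M1 f1 c1 F \<theta> = levy_exponent M2 f2 c2 F \<theta>"
  shows "(\<integral>x. (1 - cos (h * f1 s x)) *\<^sub>R iexp (\<Sum>t\<in>F. \<theta> t * f1 t x) \<partial>M1) =
    (\<integral>x. (1 - cos (h * f2 s x)) *\<^sub>R iexp (\<Sum>t\<in>F. \<theta> t * f2 t x) \<partial>M2)"
proof -
  define \<eta> where "\<eta> t = (if t = s then h else 0)" for t
  have \<eta>: "(\<Sum>t\<in>F. \<eta> t * v t) = h * v s" for v
    using F s by (simp add: \<eta>_def if_distrib[of "\<lambda>a. a * _"] cong: if_cong)
  have id: "(\<integral>x. (1 - cos (h * f s x)) *\<^sub>R iexp (\<Sum>t\<in>F. \<theta> t * f t x) \<partial>M) =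
      levy_exponent M f c F \<theta> -
        (levy_exponent M f c F (\<lambda>t. \<theta> t + \<eta> t) + levy_exponent M f c F (\<lambda>t. \<theta> t - \<eta> t)) / 2"
    if f: "\<And>t. t \<in> F \<Longrightarrow> f t \<in> L_plus M" for M :: "'c measure" and f c
  proof -
    note int = integrable_levy_kernel[OF F f]
    have "(\<integral>x. (1 - cos (h * f s x)) *\<^sub>R iexp (\<Sum>t\<in>F. \<theta> t * f t x) \<partial>M) =
        (\<integral>x. levy_kernel F \<theta> (\<lambda>t. f t x) -
          (levy_kernel F (\<lambda>t. \<theta> t + \<eta> t) (\<lambda>t. f t x) + levy_kernel F (\<lambda>t. \<theta> t - \<eta> t) (\<lambda>t. f t x)) / 2 \<partial>M)"
      unfolding levy_kernel_second_difference \<eta> ..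
    also have "\<dots> = (\<integral>x. levy_kernel F \<theta> (\<lambda>t. f t x) \<partial>M) -
        ((\<integral>x. levy_kernel F (\<lambda>t. \<theta> t + \<eta> t) (\<lambda>t. f t x) \<partial>M) +
         (\<integral>x. levy_kernel F (\<lambda>t. \<theta> t - \<eta> t) (\<lambda>t. f t x) \<partial>M)) / 2"
      by (simp add: int)
    finally show ?thesis
      by (simp add: levy_exponent_def distrib_right left_diff_distrib sum.distrib sum_subtractf field_simps)
  qed
  show ?thesis
    using id[of f1 M1 c1] id[of f2 M2 c2] f1 f2 eq by simp
qed

text \<open>
  The measures may be infinite, so they are compared on the disjoint pieces of the cover and then summed.
\<close>

lemma measure_eqI_countable_cover:
  assumes sets: "sets M = sets N" and I: "countable I"
    and D: "\<And>i. i \<in> I \<Longrightarrow> D i \<in> sets M"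
    and cM: "AE x in M. \<exists>i\<in>I. x \<in> D i" and cN: "AE x in N. \<exists>i\<in>I. x \<in> D i"
    and eq: "\<And>i A. i \<in> I \<Longrightarrow> A \<in> sets M \<Longrightarrow> emeasure M (A \<inter> D i) = emeasure N (A \<inter> D i)"
  shows "M = N"
proof (rule measure_eqI[OF sets])
  fix A assume A: "A \<in> sets M"
  define E where "E n = (if I = {} then {} else D (from_nat_into I n))" for n :: nat
  have E: "E n \<in> sets M" for n
    using D by (auto simp: E_def from_nat_into)
  then have dE: "disjointed E n \<in> sets M" for n
    unfolding disjointed_def by auto
  have UE: "(\<Union>n. disjointed E n) = (\<Union>i\<in>I. D i)"
  proof -
    have "(\<Union>n. E n) = (\<Union>i\<in>I. D i)"
      using range_from_nat_into[OF _ I] unfolding E_def by (cases "I = {}") (auto, metis rangeE)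
    then show ?thesis
      by (simp add: UN_disjointed_eq)
  qed
  have sum: "emeasure K A = (\<Sum>n. emeasure K (A \<inter> disjointed E n))"
    if "sets K = sets M" "AE x in K. \<exists>i\<in>I. x \<in> D i" for K
  proof -
    have "emeasure K A = emeasure K (\<Union>n. A \<inter> disjointed E n)"
    proof (rule emeasure_eq_AE)
      show "AE x in K. x \<in> A \<longleftrightarrow> x \<in> (\<Union>n. A \<inter> disjointed E n)"
        using that(2) by eventually_elim (use UE in auto)
    qed (use that A dE in auto)
    also have "\<dots> = (\<Sum>n. emeasure K (A \<inter> disjointed E n))"
      using that A dE
      by (intro suminf_emeasure[symmetric]) (auto intro: disjoint_family_on_bisimulation[OF disjoint_family_disjointed])
    finally show ?thesis .
  qed
  have "emeasure M (A \<inter> disjointed E n) = emeasure N (A \<inter> disjointed E n)" for n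
  proof (cases "I = {}")
    case False
    have "disjointed E n \<subseteq> E n"
      by (auto simp: disjointed_def)
    then have "A \<inter> disjointed E n = (A \<inter> disjointed E n) \<inter> D (from_nat_into I n)"
      using False by (auto simp: E_def)
    then show ?thesis
      using eq[of "from_nat_into I n" "A \<inter> disjointed E n"] A dE False by (simp add: from_nat_into)
  qed (simp add: E_def disjointed_def)
  then show "emeasure M A = emeasure N A"
    using sum[of M] sum[of N] cM cN sets by simp
qed

text \<open>
  Boxes over a finite \<open>J\<close> are handled by the Fourier transform over \<open>insert s J\<close>, which contains the
  direction \<open>s\<close> of the second difference; if \<open>s \<notin> J\<close>, that coordinate is left unconstrained (\<open>A'\<close>).
\<close>

lemma cos_weighted_distr_eq:
  fixes f1 :: "'t \<Rightarrow> 'a \<Rightarrow> real" and f2 :: "'t \<Rightarrow> 'b \<Rightarrow> real"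
  assumes f1: "\<And>t. t \<in> S \<Longrightarrow> f1 t \<in> L_plus M1" and f2: "\<And>t. t \<in> S \<Longrightarrow> f2 t \<in> L_plus M2"
    and eq: "\<And>F \<theta>. finite F \<Longrightarrow> F \<subseteq> S \<Longrightarrow> levy_exponent M1 f1 c1 F \<theta> = levy_exponent M2 f2 c2 F \<theta>"
    and s: "s \<in> S"
  shows "distr (density M1 (\<lambda>x. ennreal (1 - cos (h * f1 s x)))) (Pi\<^sub>M S (\<lambda>_. borel)) (\<lambda>x. \<lambda>t\<in>S. f1 t x) =
    distr (density M2 (\<lambda>x. ennreal (1 - cos (h * f2 s x)))) (Pi\<^sub>M S (\<lambda>_. borel)) (\<lambda>x. \<lambda>t\<in>S. f2 t x)"
    (is "distr ?N1 ?P ?F1 = distr ?N2 ?P ?F2")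
proof -
  have m1[measurable]: "f1 t \<in> borel_measurable M1" if "t \<in> S" for t
    using L_plus_measurable[OF f1[OF that]] .
  have m2[measurable]: "f2 t \<in> borel_measurable M2" if "t \<in> S" for t
    using L_plus_measurable[OF f2[OF that]] .
  have fin: "finite_measure (density M (\<lambda>x. ennreal (1 - cos (h * f x))))" if f: "f \<in> L_plus M" for M :: "'c measure" and f
  proof -
    have [measurable]: "f \<in> borel_measurable M"
      by (rule L_plus_measurable[OF f])
    have "emeasure (density M (\<lambda>x. ennreal (1 - cos (h * f x)))) (space M) = (\<integral>\<^sup>+x. ennreal (1 - cos (h * f x)) \<partial>M)"
      by (subst emeasure_density) (auto intro!: nn_integral_cong)
    also have "\<dots> < \<infinity>"
      using cos_weight_integrable[OF f, of h] by (simp add: nn_integral_eq_integral)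
    finally show ?thesis
      by (intro finite_measureI) auto
  qed
  have fin1: "finite_measure ?N1" and fin2: "finite_measure ?N2"
    using fin f1 f2 s by blast+
  have F1[measurable]: "?F1 \<in> measurable M1 ?P" and F2[measurable]: "?F2 \<in> measurable M2 ?P"
    using m1 m2 by (auto intro!: measurable_restrict)
  show ?thesis
  proof (rule measure_eqI_PiM_infinite)
    show "finite_measure (distr ?N1 ?P ?F1)"
      by (intro finite_measure.finite_measure_distr fin1) simp
    fix A :: "'t \<Rightarrow> real set" and J assume J: "finite J" "J \<subseteq> S" and A: "\<And>i. i \<in> J \<Longrightarrow> A i \<in> sets borel"
    define A' where "A' t = (if t \<in> J then A t else UNIV)" for t
    have F: "finite (insert s J)" "insert s J \<subseteq> S"
      using J s by auto
    have box: "measure ?N1 {x \<in> space ?N1. \<forall>t\<in>insert s J. f1 t x \<in> A' t} = measure ?N2 {x \<in> space ?N2. \<forall>t\<in>insert s J. f2 t x \<in> A' t}"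
    proof (rule finite_measure_boxes_eq[OF F(1) fin1 fin2])
      show "A' t \<in> sets borel" for t
        using A by (auto simp: A'_def)
      show "f1 t \<in> borel_measurable ?N1" "f2 t \<in> borel_measurable ?N2" if "t \<in> insert s J" for t
        using m1[of t] m2[of t] that F by auto
      fix \<theta> :: "'t \<Rightarrow> real"
      have [measurable]: "(\<lambda>x. \<Sum>t\<in>insert s J. \<theta> t * f1 t x) \<in> borel_measurable M1"
        "(\<lambda>x. \<Sum>t\<in>insert s J. \<theta> t * f2 t x) \<in> borel_measurable M2"
        using m1 m2 F by (auto intro!: borel_measurable_sum borel_measurable_times)
      have [measurable]: "f1 s \<in> borel_measurable M1" "f2 s \<in> borel_measurable M2"
        using m1 m2 s by auto
      have e: "levy_exponent M1 f1 c1 (insert s J) \<theta> = levy_exponent M2 f2 c2 (insert s J) \<theta>" for \<theta>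
        by (rule eq[OF F])
      have "(\<integral>x. (1 - cos (h * f1 s x)) *\<^sub>R iexp (\<Sum>t\<in>insert s J. \<theta> t * f1 t x) \<partial>M1) =
          (\<integral>x. (1 - cos (h * f2 s x)) *\<^sub>R iexp (\<Sum>t\<in>insert s J. \<theta> t * f2 t x) \<partial>M2)"
        by (rule cos_weighted_char_eq[OF F(1) _ _ _ e]) (use f1 f2 F in auto)
      then show "(\<integral>x. iexp (\<Sum>t\<in>insert s J. \<theta> t * f1 t x) \<partial>?N1) = (\<integral>x. iexp (\<Sum>t\<in>insert s J. \<theta> t * f2 t x) \<partial>?N2)"
        by (simp add: integral_density del: sum.insert of_real_sum of_real_mult)
    qed
    have em: "emeasure (distr (density M (\<lambda>x. ennreal (w x))) ?P (\<lambda>x. \<lambda>t\<in>S. f t x)) (prod_emb S (\<lambda>_. borel) J (Pi\<^sub>E J A)) =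
        emeasure (density M (\<lambda>x. ennreal (w x))) {x \<in> space (density M (\<lambda>x. ennreal (w x))). \<forall>t\<in>insert s J. f t x \<in> A' t}"
      if [measurable]: "(\<lambda>x. \<lambda>t\<in>S. f t x) \<in> measurable M ?P" for M :: "'c measure" and w f
    proof -
      have "prod_emb S (\<lambda>_. borel) J (Pi\<^sub>E J A) \<in> sets ?P"
        using J A by (intro sets_PiM_I) auto
      moreover have "(\<lambda>x. \<lambda>t\<in>S. f t x) -` prod_emb S (\<lambda>_. borel) J (Pi\<^sub>E J A) \<inter> space M = {x \<in> space M. \<forall>t\<in>insert s J. f t x \<in> A' t}"
        using J by (auto simp: prod_emb_def A'_def subset_eq PiE_iff)
      ultimately show ?thesis
        by (simp add: emeasure_distr)
    qed
    show "emeasure (distr ?N1 ?P ?F1) (prod_emb S (\<lambda>_. borel) J (Pi\<^sub>E J A)) =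
        emeasure (distr ?N2 ?P ?F2) (prod_emb S (\<lambda>_. borel) J (Pi\<^sub>E J A))"
      unfolding em[OF F1] em[OF F2] using box
      by (simp add: finite_measure.emeasure_eq_measure[OF fin1] finite_measure.emeasure_eq_measure[OF fin2])
  qed simp_all
qed

lemma emeasure_support_eq_of_density_eq:
  assumes sets: "sets M = sets N" and w[measurable]: "w \<in> borel_measurable M" and nonneg: "\<And>x. 0 \<le> w x"
    and eq: "density M (\<lambda>x. ennreal (w x)) = density N (\<lambda>x. ennreal (w x))"
    and A[measurable]: "A \<in> sets M"
  shows "emeasure M (A \<inter> {x \<in> space M. w x \<noteq> 0}) = emeasure N (A \<inter> {x \<in> space M. w x \<noteq> 0})"
proof -
  have *: "emeasure K (A \<inter> {x \<in> space M. w x \<noteq> 0}) = (\<integral>\<^sup>+x. ennreal (1 / w x) * indicator A x \<partial>density K (\<lambda>x. ennreal (w x)))"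
    if K[measurable_cong]: "sets K = sets M" for K
  proof -
    have "(\<integral>\<^sup>+x. ennreal (1 / w x) * indicator A x \<partial>density K (\<lambda>x. ennreal (w x))) =
        (\<integral>\<^sup>+x. ennreal (w x) * (ennreal (1 / w x) * indicator A x) \<partial>K)"
      by (intro nn_integral_density) auto
    also have "\<dots> = (\<integral>\<^sup>+x. indicator (A \<inter> {x \<in> space M. w x \<noteq> 0}) x \<partial>K)"
      using sets_eq_imp_space_eq[OF K] nonneg
      by (intro nn_integral_cong) (auto simp: indicator_def ennreal_mult[symmetric])
    finally show ?thesis
      by simp
  qed
  show ?thesis
    using *[of M] *[of N] sets eq by simp
qed

text \<open>
  Dividing out the weight \<open>1 - cos (h y\<^sub>s)\<close> identifies the two image measures where the weight does not
  vanish. With \<open>h = 1 / (n + 1)\<close> these sets cover every \<open>y \<noteq> 0\<close>, since \<open>0 < \<bar>h y\<^sub>s\<bar> < 1\<close> for a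
  coordinate \<open>y\<^sub>s \<noteq> 0\<close> and large \<open>n\<close>; the support conditions make the origin a null set.
\<close>

lemma distr_eq_of_levy_exponent_eq:
  fixes f1 :: "'t \<Rightarrow> 'a \<Rightarrow> real" and f2 :: "'t \<Rightarrow> 'b \<Rightarrow> real"
  assumes f1: "\<And>t. t \<in> S \<Longrightarrow> f1 t \<in> L_plus M1" and f2: "\<And>t. t \<in> S \<Longrightarrow> f2 t \<in> L_plus M2"
    and eq: "\<And>F \<theta>. finite F \<Longrightarrow> F \<subseteq> S \<Longrightarrow> levy_exponent M1 f1 c1 F \<theta> = levy_exponent M2 f2 c2 F \<theta>"
    and S: "countable S"
    and supp1: "AE x in M1. \<exists>t\<in>S. f1 t x \<noteq> 0" and supp2: "AE x in M2. \<exists>t\<in>S. f2 t x \<noteq> 0"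
  shows "distr M1 (Pi\<^sub>M S (\<lambda>_. borel)) (\<lambda>x. \<lambda>t\<in>S. f1 t x) = distr M2 (Pi\<^sub>M S (\<lambda>_. borel)) (\<lambda>x. \<lambda>t\<in>S. f2 t x)"
    (is "distr M1 ?P ?F1 = distr M2 ?P ?F2")
proof -
  have F1[measurable]: "?F1 \<in> measurable M1 ?P" and F2[measurable]: "?F2 \<in> measurable M2 ?P"
    using f1 f2 by (auto intro!: measurable_restrict L_plus_measurable)
  define w where "w s n y = 1 - cos (inverse (real (Suc n)) * y s)" for s :: 't and n :: nat and y :: "'t \<Rightarrow> real"
  define D where "D = (\<lambda>(s, n). {y \<in> space ?P. w s n y \<noteq> 0})"
  have wm[measurable]: "w s n \<in> borel_measurable ?P" if "s \<in> S" for s n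
    unfolding w_def using that by measurable
  have w_nonneg: "0 \<le> w s n y" for s n y
    by (simp add: w_def)
  have cover: "\<exists>n. w s n y \<noteq> 0" if "y s \<noteq> 0" for s y
  proof -
    obtain n where n: "\<bar>y s\<bar> < real (Suc n)"
      using reals_Archimedean2[of "\<bar>y s\<bar>"] by (metis less_SucI of_nat_less_iff order_less_trans lessI)
    define z where "z = inverse (real (Suc n)) * y s"
    have "z \<noteq> 0" "\<bar>z\<bar> < 1"
      using that n by (auto simp: z_def abs_mult field_simps)
    then have "cos \<bar>z\<bar> < cos 0"
      using pi_gt3 by (intro cos_monotone_0_pi) auto
    then show ?thesis
      by (intro exI[of _ n]) (simp add: w_def z_def)
  qed
  have coverage: "AE y in distr M ?P (\<lambda>x. \<lambda>t\<in>S. f t x). \<exists>i\<in>S \<times> UNIV. y \<in> D i"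
    if [measurable]: "(\<lambda>x. \<lambda>t\<in>S. f t x) \<in> measurable M ?P" and supp: "AE x in M. \<exists>t\<in>S. f t x \<noteq> 0"
    for M :: "'c measure" and f
  proof (subst AE_distr_iff)
    have "countable (S \<times> (UNIV :: nat set))"
      using S by simp
    then have "(\<Union>i\<in>S \<times> UNIV. D i) \<in> sets ?P"
      by (rule sets.countable_UN'') (auto simp: D_def)
    moreover have "(\<Union>i\<in>S \<times> UNIV. D i) = {y \<in> space ?P. \<exists>i\<in>S \<times> UNIV. y \<in> D i}"
      by (auto simp: D_def)
    ultimately show "{y \<in> space ?P. \<exists>i\<in>S \<times> UNIV. y \<in> D i} \<in> sets ?P"
      by simp
    show "AE x in M. \<exists>i\<in>S \<times> UNIV. (\<lambda>t\<in>S. f t x) \<in> D i"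
      using supp AE_space
    proof eventually_elim
      case (elim x)
      then obtain t where t: "t \<in> S" "f t x \<noteq> 0" by auto
      obtain n where "w t n (\<lambda>t\<in>S. f t x) \<noteq> 0"
        using cover[of "\<lambda>t\<in>S. f t x" t] t by auto
      moreover have "(\<lambda>t\<in>S. f t x) \<in> space ?P"
        using measurable_space[OF that(1) elim(2)] .
      ultimately show ?case
        using t by (intro bexI[of _ "(t, n)"]) (auto simp: D_def)
    qed
  qed (rule that(1))
  show ?thesis
  proof (rule measure_eqI_countable_cover[where I="S \<times> UNIV" and D=D])
    fix i A assume i: "i \<in> S \<times> (UNIV :: nat set)" and A: "A \<in> sets (distr M1 ?P ?F1)"
    obtain s n where sn: "i = (s, n)" "s \<in> S"
      using i by auto
    have d: "density (distr M ?P (\<lambda>x. \<lambda>t\<in>S. f t x)) (\<lambda>x. ennreal (w s n x)) =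
        distr (density M (\<lambda>x. ennreal (1 - cos (inverse (real (Suc n)) * f s x)))) ?P (\<lambda>x. \<lambda>t\<in>S. f t x)"
      if "(\<lambda>x. \<lambda>t\<in>S. f t x) \<in> measurable M ?P" for M :: "'c measure" and f
      using that wm[OF sn(2), of n] sn(2) by (subst density_distr) (auto simp: w_def)
    have "density (distr M1 ?P ?F1) (\<lambda>x. ennreal (w s n x)) = density (distr M2 ?P ?F2) (\<lambda>x. ennreal (w s n x))"
      unfolding d[OF F1] d[OF F2] by (rule cos_weighted_distr_eq[OF f1 f2 eq sn(2)])
    then have "emeasure (distr M1 ?P ?F1) (A \<inter> {y \<in> space (distr M1 ?P ?F1). w s n y \<noteq> 0}) =
        emeasure (distr M2 ?P ?F2) (A \<inter> {y \<in> space (distr M1 ?P ?F1). w s n y \<noteq> 0})"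
      using wm[OF sn(2)] A by (intro emeasure_support_eq_of_density_eq) (auto simp: w_nonneg)
    then show "emeasure (distr M1 ?P ?F1) (A \<inter> D i) = emeasure (distr M2 ?P ?F2) (A \<inter> D i)"
      by (simp add: D_def sn)
  next
    show "AE y in distr M1 ?P ?F1. \<exists>i\<in>S \<times> UNIV. y \<in> D i" "AE y in distr M2 ?P ?F2. \<exists>i\<in>S \<times> UNIV. y \<in> D i"
      by (rule coverage[OF F1 supp1], rule coverage[OF F2 supp2])
  qed (use S in \<open>auto simp: D_def\<close>)
qed

text \<open>
  Equal finite-dimensional laws have equal characteristic functions, and the shift \<open>c\<close> contributes the linear
  term of the exponent.
\<close>

lemma spectral_representation_char:
  fixes X :: "'t \<Rightarrow> 'p \<Rightarrow> real" and f :: "'t \<Rightarrow> 'a \<Rightarrow> real"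
  assumes X: "\<And>t. t \<in> T \<Longrightarrow> X t \<in> borel_measurable P"
    and spec: "spectral_representation T P X M f"
  obtains c where "\<And>F \<theta>. finite F \<Longrightarrow> F \<subseteq> T \<Longrightarrow>
    (\<integral>\<omega>. iexp (\<Sum>t\<in>F. \<theta> t * X t \<omega>) \<partial>P) = exp (levy_exponent M f c F \<theta>)"
proof -
  from spec obtain Q :: "(nat \<Rightarrow> 'a option) measure" and J U I c where
    poi: "poisson_point_process Q M J U" and
    I: "\<And>t. t \<in> T \<Longrightarrow> is_poisson_integral Q M J U (f t) (I t)" and
    fdd: "fdd_equal T P X Q (\<lambda>t \<omega>. I t \<omega> + c t)" and
    f: "\<And>t. t \<in> T \<Longrightarrow> f t \<in> L_plus M"
    unfolding spectral_representation_def by blast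
  interpret poisson_process Q M J U
    by unfold_locales (rule poi)
  have [measurable]: "I t \<in> borel_measurable Q" if "t \<in> T" for t
    using I[OF that] by (simp add: is_poisson_integral_def)
  show ?thesis
  proof (rule that)
    fix F :: "'t set" and \<theta> assume F: "finite F" "F \<subseteq> T"
    let ?P = "Pi\<^sub>M F (\<lambda>_. borel) :: ('t \<Rightarrow> real) measure"
    have [measurable]: "(\<lambda>y. \<Sum>t\<in>F. \<theta> t * y t) \<in> borel_measurable ?P"
      by (intro borel_measurable_sum) auto
    have "(\<integral>\<omega>. iexp (\<Sum>t\<in>F. \<theta> t * X t \<omega>) \<partial>P) = (\<integral>y. iexp (\<Sum>t\<in>F. \<theta> t * y t) \<partial>distr P ?P (\<lambda>\<omega>. \<lambda>t\<in>F. X t \<omega>))"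
      using X F by (subst integral_distr) (auto intro!: measurable_restrict)
    also have "distr P ?P (\<lambda>\<omega>. \<lambda>t\<in>F. X t \<omega>) = distr Q ?P (\<lambda>\<omega>. \<lambda>t\<in>F. I t \<omega> + c t)"
      using fdd F by (simp add: fdd_equal_def)
    also have "(\<integral>y. iexp (\<Sum>t\<in>F. \<theta> t * y t) \<partial>distr Q ?P (\<lambda>\<omega>. \<lambda>t\<in>F. I t \<omega> + c t)) =
        (\<integral>\<omega>. iexp (\<Sum>t\<in>F. \<theta> t * (I t \<omega> + c t)) \<partial>Q)"
      using F by (subst integral_distr) (auto intro!: measurable_restrict borel_measurable_add)
    also have "\<dots> = (\<integral>\<omega>. iexp (\<Sum>t\<in>F. \<theta> t * c t) * iexp (\<Sum>t\<in>F. \<theta> t * I t \<omega>) \<partial>Q)"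
      by (simp add: exp_add[symmetric] distrib_left sum.distrib add.commute)
    also have "\<dots> = iexp (\<Sum>t\<in>F. \<theta> t * c t) * exp (\<integral>x. levy_kernel F \<theta> (\<lambda>t. f t x) \<partial>M)"
      using integral_iexp_poisson_integrals[of F f I \<theta>] F f I by (simp add: subset_eq)
    also have "\<dots> = exp (levy_exponent M f c F \<theta>)"
      by (simp add: levy_exponent_def exp_add)
    finally show "(\<integral>\<omega>. iexp (\<Sum>t\<in>F. \<theta> t * X t \<omega>) \<partial>P) = exp (levy_exponent M f c F \<theta>)" .
  qed
qed

section \<open>Reduction to countably many coordinates\<close>

text \<open>
  Exhaustion: with respect to an equivalent finite measure, choose a countable \<open>S\<close> whose joint support has
  the largest possible measure. Adding one more \<open>t\<close> cannot enlarge it, so every \<open>f t\<close> vanishes almost everywhere off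
  that support, and the complement is null by the second minimality condition.
\<close>

lemma countable_subfamily_with_full_support:
  fixes f :: "'t \<Rightarrow> 'a \<Rightarrow> real"
  assumes "sigma_finite_measure M" and f[measurable]: "\<And>t. t \<in> T \<Longrightarrow> f t \<in> borel_measurable M"
    and full: "\<not> (\<exists>B\<in>sets M. emeasure M B > 0 \<and> (\<forall>t\<in>T. AE x in M. x \<in> B \<longrightarrow> f t x = 0))"
  obtains S where "countable S" "S \<subseteq> T" "AE x in M. \<exists>t\<in>S. f t x \<noteq> 0"
proof -
  interpret sigma_finite_measure M by fact
  obtain h where h[measurable]: "h \<in> borel_measurable M" and h_fin: "integral\<^sup>N M h \<noteq> \<infinity>"
    and h_pos: "\<And>x. x \<in> space M \<Longrightarrow> 0 < h x"
    using Ex_finite_integrable_function by blast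
  define N where "N = density M h"
  have sets_N: "sets N = sets M" "space N = space M"
    by (simp_all add: N_def)
  have "emeasure N (space N) = integral\<^sup>N M h"
    unfolding N_def by (subst emeasure_density) (auto intro!: nn_integral_cong)
  then interpret N: finite_measure N
    using h_fin by (intro finite_measureI) simp
  have AE_N: "(AE x in N. R x) \<longleftrightarrow> (AE x in M. R x)" for R
    unfolding N_def using h_pos by (subst AE_density) (auto intro!: AE_cong)
  define supp where "supp C = (\<Union>t\<in>C. {x \<in> space M. f t x \<noteq> 0})" for C
  have supp[measurable]: "supp C \<in> sets N" if "countable C" "C \<subseteq> T" for C
    unfolding supp_def sets_N using that
    by (intro sets.countable_UN'') (auto intro!: borel_measurable_neq f)
  define V where "V = (\<lambda>C. emeasure N (supp C)) ` {C. countable C \<and> C \<subseteq> T}"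
  have "V \<noteq> {}"
    by (auto simp: V_def)
  then obtain v :: "nat \<Rightarrow> ennreal" where v: "range v \<subseteq> V" "Sup V = (SUP n. v n)"
    using ennreal_Sup_countable_SUP[of V] by blast
  have "\<forall>n. \<exists>C. countable C \<and> C \<subseteq> T \<and> v n = emeasure N (supp C)"
    using v(1) by (auto simp: V_def)
  then obtain C where C: "\<And>n. countable (C n)" "\<And>n. C n \<subseteq> T" "\<And>n. v n = emeasure N (supp (C n))"
    by metis
  define S where "S = (\<Union>n. C n)"
  have S: "countable S" "S \<subseteq> T"
    using C by (auto simp: S_def)
  have "Sup V \<le> emeasure N (supp S)"
    unfolding v(2)
  proof (rule SUP_least)
    fix n
    show "v n \<le> emeasure N (supp S)"
      unfolding C(3) using supp[OF S] by (intro emeasure_mono) (auto simp: supp_def S_def)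
  qed
  have null: "AE x in M. x \<in> space M - supp S \<longrightarrow> f t x = 0" if t: "t \<in> T" for t
  proof -
    have S': "countable (insert t S)" "insert t S \<subseteq> T"
      using S t by auto
    have "emeasure N (supp (insert t S)) \<le> Sup V"
      using S' by (intro Sup_upper) (auto simp: V_def)
    then have le: "emeasure N (supp (insert t S)) \<le> emeasure N (supp S)"
      using \<open>Sup V \<le> emeasure N (supp S)\<close> by (rule order_trans)
    have sub: "supp S \<subseteq> supp (insert t S)"
      by (auto simp: supp_def)
    have "emeasure N (supp (insert t S) - supp S) = emeasure N (supp (insert t S)) - emeasure N (supp S)"
      by (intro emeasure_Diff supp S S' sub) simp
    also have "\<dots> = 0"
      using le by (simp add: diff_eq_0_iff_ennreal less_top[symmetric])
    finally have "supp (insert t S) - supp S \<in> null_sets N"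
      using supp[OF S] supp[OF S'] by auto
    then have "AE x in N. x \<notin> supp (insert t S) - supp S"
      by (rule AE_not_in)
    then show ?thesis
      unfolding AE_N by eventually_elim (auto simp: supp_def)
  qed
  have B: "space M - supp S \<in> sets M"
    using supp[OF S] sets_N by auto
  then have "emeasure M (space M - supp S) = 0"
    using full null by (metis not_gr_zero)
  then have "AE x in M. x \<notin> space M - supp S"
    using B by (intro AE_not_in) auto
  then have "AE x in M. \<exists>t\<in>S. f t x \<noteq> 0"
    using AE_space by eventually_elim (auto simp: supp_def)
  then show ?thesis
    using S that by blast
qed

text \<open>
  The conclusion is stated for all \<open>S' \<supseteq> S\<close> so that countably many generated sets can be described by
  one common family of coordinates.
\<close>

lemma generated_set_depends_on_countably_many:
  fixes f :: "'t \<Rightarrow> 'a \<Rightarrow> real"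
  assumes f: "\<And>t. t \<in> T \<Longrightarrow> f t \<in> borel_measurable M"
    and A: "A \<in> sigma_sets (space M) (\<Union>t\<in>T. {f t -` B \<inter> space M | B. B \<in> sets borel})"
  shows "\<exists>S. countable S \<and> S \<subseteq> T \<and> (\<forall>S'. S \<subseteq> S' \<longrightarrow>
    (\<exists>C\<in>sets (Pi\<^sub>M S' (\<lambda>_. borel)). A = {x \<in> space M. (\<lambda>t\<in>S'. f t x) \<in> C}))"
  using A
proof (induction rule: sigma_sets.induct)
  case (Basic A)
  then obtain t B where tB: "t \<in> T" "B \<in> sets borel" "A = f t -` B \<inter> space M"
    by auto
  show ?case
  proof (intro exI[of _ "{t}"] conjI allI impI)
    fix S' assume S': "{t} \<subseteq> S'"
    then have [simp]: "t \<in> S'"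
      by simp
    have "{y \<in> space (Pi\<^sub>M S' (\<lambda>_. borel)). y t \<in> B} \<in> sets (Pi\<^sub>M S' (\<lambda>_. borel))"
      using S' tB(2) by measurable
    moreover have "A = {x \<in> space M. (\<lambda>t\<in>S'. f t x) \<in> {y \<in> space (Pi\<^sub>M S' (\<lambda>_. borel)). y t \<in> B}}"
      using S' tB by (auto simp: space_PiM)
    ultimately show "\<exists>C\<in>sets (Pi\<^sub>M S' (\<lambda>_. borel)). A = {x \<in> space M. (\<lambda>t\<in>S'. f t x) \<in> C}"
      by blast
  qed (use tB in auto)
next
  case Empty
  show ?case
    by (intro exI[of _ "{}"] conjI allI impI bexI[of _ "{}"]) auto
next
  case (Compl A)
  then obtain S where S: "countable S" "S \<subseteq> T"
    "\<And>S'. S \<subseteq> S' \<Longrightarrow> \<exists>C\<in>sets (Pi\<^sub>M S' (\<lambda>_. borel)). A = {x \<in> space M. (\<lambda>t\<in>S'. f t x) \<in> C}"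
    by blast
  show ?case
  proof (intro exI[of _ S] conjI allI impI S)
    fix S' assume "S \<subseteq> S'"
    then obtain C where C: "C \<in> sets (Pi\<^sub>M S' (\<lambda>_. borel))" "A = {x \<in> space M. (\<lambda>t\<in>S'. f t x) \<in> C}"
      using S(3) by blast
    have "space M - A = {x \<in> space M. (\<lambda>t\<in>S'. f t x) \<in> space (Pi\<^sub>M S' (\<lambda>_. borel)) - C}"
      using C(2) by (auto simp: space_PiM)
    then show "\<exists>C\<in>sets (Pi\<^sub>M S' (\<lambda>_. borel)). space M - A = {x \<in> space M. (\<lambda>t\<in>S'. f t x) \<in> C}"
      by (rule bexI) (use C(1) in auto)
  qed
next
  case (Union A)
  have "\<exists>S. \<forall>i. countable (S i) \<and> S i \<subseteq> T \<and> (\<forall>S'. S i \<subseteq> S' \<longrightarrow>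
      (\<exists>C\<in>sets (Pi\<^sub>M S' (\<lambda>_. borel)). A i = {x \<in> space M. (\<lambda>t\<in>S'. f t x) \<in> C}))"
    by (intro choice allI Union.IH)
  then obtain S where S0: "\<forall>i. countable (S i) \<and> S i \<subseteq> T \<and> (\<forall>S'. S i \<subseteq> S' \<longrightarrow>
      (\<exists>C\<in>sets (Pi\<^sub>M S' (\<lambda>_. borel)). A i = {x \<in> space M. (\<lambda>t\<in>S'. f t x) \<in> C}))" ..
  have S: "\<And>i. countable (S i)" "\<And>i. S i \<subseteq> T"
    "\<And>i S'. S i \<subseteq> S' \<Longrightarrow> \<exists>C\<in>sets (Pi\<^sub>M S' (\<lambda>_. borel)). A i = {x \<in> space M. (\<lambda>t\<in>S'. f t x) \<in> C}"
    using S0 by simp_all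
  show ?case
  proof (intro exI[of _ "\<Union>i. S i"] conjI allI impI)
    fix S' assume S': "(\<Union>i. S i) \<subseteq> S'"
    have "\<exists>C. \<forall>i. C i \<in> sets (Pi\<^sub>M S' (\<lambda>_. borel)) \<and> A i = {x \<in> space M. (\<lambda>t\<in>S'. f t x) \<in> C i}"
    proof (intro choice allI)
      fix i
      have "S i \<subseteq> S'"
        using S' by auto
      then show "\<exists>C. C \<in> sets (Pi\<^sub>M S' (\<lambda>_. borel)) \<and> A i = {x \<in> space M. (\<lambda>t\<in>S'. f t x) \<in> C}"
        using S(3) by (simp add: Bex_def)
    qed
    then obtain C where C0: "\<forall>i. C i \<in> sets (Pi\<^sub>M S' (\<lambda>_. borel)) \<and> A i = {x \<in> space M. (\<lambda>t\<in>S'. f t x) \<in> C i}" ..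
    have C: "\<And>i. C i \<in> sets (Pi\<^sub>M S' (\<lambda>_. borel))" "\<And>i. A i = {x \<in> space M. (\<lambda>t\<in>S'. f t x) \<in> C i}"
      using C0 by simp_all
    show "\<exists>C\<in>sets (Pi\<^sub>M S' (\<lambda>_. borel)). (\<Union>i. A i) = {x \<in> space M. (\<lambda>t\<in>S'. f t x) \<in> C}"
      using C by (intro bexI[of _ "\<Union>i. C i"]) auto
  qed (use S in auto)
qed

section \<open>Borel spaces as complete separable metric spaces\<close>

text \<open>
  The metric of a Borel space pulled back along the bijection, so that the points of the metric space are
  those of \<open>M\<close>. The sequence \<open>q\<close> is dense, possibly with repetitions; its balls generate the
  \<open>\<sigma>\<close>-algebra, and measurability of maps into \<open>M\<close> can be tested on the real functions \<open>d (q k)\<close>.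
\<close>

locale polish_measure = Metric_space "space M" d
  for M :: "'a measure" and d :: "'a \<Rightarrow> 'a \<Rightarrow> real" +
  fixes q :: "nat \<Rightarrow> 'a"
  assumes complete: "\<And>\<sigma>. \<lbrakk>\<And>n. \<sigma> n \<in> space M; \<And>e. 0 < e \<Longrightarrow> \<exists>N. \<forall>m\<ge>N. \<forall>n\<ge>N. d (\<sigma> m) (\<sigma> n) < e\<rbrakk>
      \<Longrightarrow> \<exists>l\<in>space M. (\<lambda>n. d (\<sigma> n) l) \<longlonglongrightarrow> 0"
    and q_in_space: "q k \<in> space M"
    and q_dense: "\<And>y e. y \<in> space M \<Longrightarrow> 0 < e \<Longrightarrow> \<exists>k. d (q k) y < e"
    and sets_eq_balls: "sets M = sigma_sets (space M) {{x \<in> space M. d (q k) x < r} | k r. True}"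
begin

lemma dist_measurable [measurable]: "(\<lambda>x. d (q k) x) \<in> borel_measurable M"
  unfolding borel_measurable_iff_less sets_eq_balls by (auto intro: sigma_sets.Basic)

lemma measurable_into:
  assumes "\<And>x. x \<in> space N \<Longrightarrow> h x \<in> space M" and "\<And>k. (\<lambda>x. d (q k) (h x)) \<in> borel_measurable N"
  shows "h \<in> measurable N M"
proof (rule measurable_sigma_sets[OF sets_eq_balls])
  fix A assume "A \<in> {{x \<in> space M. d (q k) x < r} | k r. True}"
  then obtain k r where "A = {x \<in> space M. d (q k) x < r}"
    by blast
  then have "h -` A \<inter> space N = {x \<in> space N. d (q k) (h x) < r}"
    using assms(1) by auto
  also have "\<dots> \<in> sets N"
    using assms(2) by measurable
  finally show "h -` A \<inter> space N \<in> sets N" .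
qed (use assms(1) in auto)

lemma eq_if_same_distances:
  assumes "x \<in> space M" "y \<in> space M" and eq: "\<And>k. d (q k) x = d (q k) y"
  shows "x = y"
proof (rule ccontr)
  assume "x \<noteq> y"
  then have "0 < d x y / 2"
    using assms mdist_pos_eq by simp
  then obtain k where "d (q k) x < d x y / 2"
    using q_dense assms(1) by blast
  moreover have "d x y \<le> d (q k) x + d (q k) y"
    using triangle[of x "q k" y] assms q_in_space commute by metis
  ultimately show False
    using eq[of k] by simp
qed

lemma sets_Collect_eq:
  assumes [measurable]: "u \<in> measurable N M" "v \<in> measurable N M"
  shows "{x \<in> space N. u x = v x} \<in> sets N"
proof -
  have "{x \<in> space N. u x = v x} = {x \<in> space N. \<forall>k. d (q k) (u x) = d (q k) (v x)}"
  proof (intro Collect_cong conj_cong refl)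
    fix x assume "x \<in> space N"
    then show "u x = v x \<longleftrightarrow> (\<forall>k. d (q k) (u x) = d (q k) (v x))"
      using eq_if_same_distances[of "u x" "v x"] measurable_space[OF assms(1)] measurable_space[OF assms(2)]
      by auto
  qed
  also have "\<dots> \<in> sets N"
    by measurable
  finally show ?thesis .
qed

end

lemma borel_space_imp_polish_measure:
  assumes "borel_space M"
  obtains d q where "polish_measure M d q"
proof -
  obtain m :: "'a metric" and \<phi> where ne: "mspace m \<noteq> {}" and cpl: "mcomplete_of m"
    and sep: "separable_space (mtopology_of m)"
    and bi: "bimeasurable_bijection M (sigma (mspace m) {G. openin (mtopology_of m) G}) \<phi>"
    using assms unfolding borel_space_def by blast
  interpret m: Metric_space "mspace m" "mdist m"
    by (rule Metric_space_mspace_mdist)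
  define \<N> where "\<N> = sigma (mspace m) {G. openin (mtopology_of m) G}"
  define \<psi> where "\<psi> = the_inv_into (space M) \<phi>"
  have opens: "{G. openin (mtopology_of m) G} \<subseteq> Pow (mspace m)"
    using openin_subset[of "mtopology_of m"] by auto
  have space_N: "space \<N> = mspace m" and sets_N: "sets \<N> = sigma_sets (mspace m) {G. openin (mtopology_of m) G}"
    using opens by (simp_all add: \<N>_def)
  have bij: "bij_betw \<phi> (space M) (mspace m)" and \<phi>[measurable]: "\<phi> \<in> measurable M \<N>" and \<psi>[measurable]: "\<psi> \<in> measurable \<N> M"
    using bi space_N by (simp_all add: bimeasurable_bijection_def \<N>_def \<psi>_def)
  have \<phi>_in: "\<phi> x \<in> mspace m" if "x \<in> space M" for x
    using bij that by (auto simp: bij_betw_def)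
  have \<psi>_in: "\<psi> y \<in> space M" and \<phi>\<psi>: "\<phi> (\<psi> y) = y" if "y \<in> mspace m" for y
    using bij that measurable_space[OF \<psi>] f_the_inv_into_f_bij_betw[OF bij]
    by (auto simp: space_N \<psi>_def)
  have \<psi>\<phi>: "\<psi> (\<phi> x) = x" if "x \<in> space M" for x
    using bij that by (auto simp: bij_betw_def \<psi>_def the_inv_into_f_f)
  obtain D where D: "countable D" "D \<subseteq> mspace m" "mtopology_of m closure_of D = mspace m"
    using sep by (auto simp: separable_space_def)
  have D_dense: "\<exists>z\<in>D. mdist m z y < e" if "y \<in> mspace m" "0 < e" for y e
  proof -
    have "y \<in> m.mtopology closure_of D"
      using D(3) that by (simp add: mtopology_of_def)
    then show ?thesis
      using that(2) by (auto simp: m.metric_closure_of m.commute)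
  qed
  have "D \<noteq> {}"
    using D_dense ne by (metis all_not_in_conv zero_less_one)
  define q where "q k = \<psi> (from_nat_into D k)" for k
  have q_in: "q k \<in> space M" and \<phi>q_in: "\<phi> (q k) \<in> mspace m" for k
    using \<psi>_in from_nat_into[OF \<open>D \<noteq> {}\<close>, of k] D(2) \<phi>\<psi> by (auto simp: q_def)
  define d where "d x y = (if x \<in> space M \<and> y \<in> space M then mdist m (\<phi> x) (\<phi> y) else 0)" for x y
  have dense: "\<exists>k. d (q k) x < e" if x: "x \<in> space M" and e: "0 < e" for x e
  proof -
    obtain z where z: "z \<in> D" "mdist m z (\<phi> x) < e"
      using D_dense[OF \<phi>_in[OF x] e] by blast
    obtain k where "from_nat_into D k = z"
      using from_nat_into_surj[OF D(1) z(1)] by blast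
    then show ?thesis
      using z x q_in D(2) \<phi>\<psi> by (intro exI[of _ k]) (auto simp: d_def q_def)
  qed
  define \<G> where "\<G> = {{x \<in> space M. d (q k) x < r} | k r. True}"
  have G_Pow: "\<G> \<subseteq> Pow (space M)"
    by (auto simp: \<G>_def)
  have \<phi>_balls: "\<phi> \<in> measurable (sigma (space M) \<G>) \<N>"
    unfolding \<N>_def
  proof (rule measurable_measure_of[OF opens])
    show "\<phi> \<in> space (sigma (space M) \<G>) \<rightarrow> mspace m"
      using \<phi>_in G_Pow by auto
    fix G assume "G \<in> {G. openin (mtopology_of m) G}"
    then have G: "openin m.mtopology G"
      by (simp add: mtopology_of_def)
    \<comment> \<open>By density, \<open>\<phi> -` G\<close> is the union of the balls around the \<open>q k\<close> with rational radius that it contains.\<close>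
    let ?I = "{(k, r). r \<in> \<rat> \<and> {x \<in> space M. d (q k) x < r} \<subseteq> \<phi> -` G}"
    have "\<phi> -` G \<inter> space M = (\<Union>(k, r)\<in>?I. {x \<in> space M. d (q k) x < r})"
    proof (intro equalityI subsetI)
      fix x assume x: "x \<in> \<phi> -` G \<inter> space M"
      then obtain r where r: "0 < r" "m.mball (\<phi> x) r \<subseteq> G"
        using G by (auto simp: m.openin_mtopology)
      obtain r' where r': "r' \<in> \<rat>" "0 < r'" "r' < r / 2"
        using Rats_dense_in_real[of 0 "r / 2"] r by auto
      obtain k where k: "d (q k) x < r'"
        using dense x r' by blast
      have "y \<in> \<phi> -` G" if y: "y \<in> space M" "d (q k) y < r'" for y
      proof -
        have "mdist m (\<phi> x) (\<phi> y) \<le> mdist m (\<phi> (q k)) (\<phi> x) + mdist m (\<phi> (q k)) (\<phi> y)"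
          using m.triangle[of "\<phi> x" "\<phi> (q k)" "\<phi> y"] m.commute \<phi>_in \<phi>q_in x y by (metis IntD2)
        also have "\<dots> < r"
          using k y r' x q_in by (simp add: d_def)
        finally show ?thesis
          using r(2) x y \<phi>_in by auto
      qed
      then show "x \<in> (\<Union>(k, r)\<in>?I. {x \<in> space M. d (q k) x < r})"
        using k r' x by (intro UN_I[of "(k, r')"]) auto
    qed auto
    moreover have "(\<Union>(k, r)\<in>?I. {x \<in> space M. d (q k) x < r}) \<in> sets (sigma (space M) \<G>)"
    proof (rule sets.countable_UN'')
      have "?I \<subseteq> UNIV \<times> \<rat>"
        by auto
      then show "countable ?I"
        by (rule countable_subset) (intro countable_SIGMA countable_rat countableI_type)
    qed (use G_Pow in \<open>auto simp: \<G>_def intro!: sigma_sets.Basic\<close>)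
    ultimately show "\<phi> -` G \<inter> space (sigma (space M) \<G>) \<in> sets (sigma (space M) \<G>)"
      using G_Pow by simp
  qed
  have sub: "sets M \<subseteq> sigma_sets (space M) \<G>"
  proof
    fix A assume A: "A \<in> sets M"
    have "(\<lambda>x. \<psi> (\<phi> x)) \<in> measurable (sigma (space M) \<G>) M"
      by (rule measurable_compose[OF \<phi>_balls \<psi>])
    then have "(\<lambda>x. \<psi> (\<phi> x)) -` A \<inter> space M \<in> sigma_sets (space M) \<G>"
      using measurable_sets[of "\<lambda>x. \<psi> (\<phi> x)" "sigma (space M) \<G>" M A] A
      by (simp add: sets_measure_of[OF G_Pow] space_measure_of[OF G_Pow])
    moreover have "(\<lambda>x. \<psi> (\<phi> x)) -` A \<inter> space M = A"
      using \<psi>\<phi> sets.sets_into_space[OF A] by auto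
    ultimately show "A \<in> sigma_sets (space M) \<G>"
      by simp
  qed
  have "\<G> \<subseteq> sets M"
  proof
    fix A assume "A \<in> \<G>"
    then obtain k r where kr: "A = {x \<in> space M. d (q k) x < r}"
      by (auto simp: \<G>_def)
    have "m.mball (\<phi> (q k)) r \<in> sets \<N>"
      unfolding sets_N by (intro sigma_sets.Basic) (simp add: mtopology_of_def)
    then have "\<phi> -` m.mball (\<phi> (q k)) r \<inter> space M \<in> sets M"
      by (rule measurable_sets[OF \<phi>])
    moreover have "\<phi> -` m.mball (\<phi> (q k)) r \<inter> space M = A"
      using kr q_in \<phi>_in by (auto simp: d_def)
    ultimately show "A \<in> sets M"
      by simp
  qed
  then have "sigma_sets (space M) \<G> \<subseteq> sets M"
    by (rule sets.sigma_sets_subset)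
  with sub have sets_M: "sets M = sigma_sets (space M) \<G>"
    by blast
  have "polish_measure M d q"
  proof (unfold_locales)
    show "0 \<le> d x y" for x y
      by (simp add: d_def)
    show "d x y = d y x" for x y
      by (simp add: d_def m.commute)
    show "d x y = 0 \<longleftrightarrow> x = y" if "x \<in> space M" "y \<in> space M" for x y
      using that \<phi>_in inj_on_eq_iff[OF bij_betw_imp_inj_on[OF bij]] by (simp add: d_def)
    show "d x z \<le> d x y + d y z" if "x \<in> space M" "y \<in> space M" "z \<in> space M" for x y z
      using that \<phi>_in m.triangle by (simp add: d_def)
    show "\<exists>l\<in>space M. (\<lambda>n. d (\<sigma> n) l) \<longlonglongrightarrow> 0"
      if \<sigma>: "\<And>n. \<sigma> n \<in> space M" and cauchy: "\<And>e. 0 < e \<Longrightarrow> \<exists>N. \<forall>m\<ge>N. \<forall>n\<ge>N. d (\<sigma> m) (\<sigma> n) < e" for \<sigma>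
    proof -
      have "m.MCauchy (\<lambda>n. \<phi> (\<sigma> n))"
        unfolding m.MCauchy_def
      proof (intro conjI allI impI)
        show "range (\<lambda>n. \<phi> (\<sigma> n)) \<subseteq> mspace m"
          using \<sigma> \<phi>_in by auto
        fix e :: real assume "0 < e"
        then obtain N where "\<forall>m\<ge>N. \<forall>n\<ge>N. d (\<sigma> m) (\<sigma> n) < e"
          using cauchy by blast
        then show "\<exists>N. \<forall>n n'. N \<le> n \<longrightarrow> N \<le> n' \<longrightarrow> mdist m (\<phi> (\<sigma> n)) (\<phi> (\<sigma> n')) < e"
          using \<sigma> by (intro exI[of _ N]) (simp add: d_def)
      qed
      then obtain y where "limitin m.mtopology (\<lambda>n. \<phi> (\<sigma> n)) y sequentially"
        using cpl unfolding mcomplete_of_def m.mcomplete_def by blast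
      then have y: "y \<in> mspace m" "(\<lambda>n. mdist m (\<phi> (\<sigma> n)) y) \<longlonglongrightarrow> 0"
        by (auto simp: m.limitin_metric_dist_null)
      then show ?thesis
        using \<sigma> \<psi>_in \<phi>\<psi> by (intro bexI[of _ "\<psi> y"]) (simp_all add: d_def)
    qed
    show "q k \<in> space M" for k
      by (rule q_in)
    show "\<exists>k. d (q k) y < e" if "y \<in> space M" "0 < e" for y e
      by (rule dense[OF that])
    show "sets M = sigma_sets (space M) {{x \<in> space M. d (q k) x < r} | k r. True}"
      using sets_M by (simp add: \<G>_def)
  qed
  then show ?thesis
    by (rule that)
qed

section \<open>Recovering a point from countably many coordinates\<close>

text \<open>
  The identity is the limit of the maps \<open>x \<mapsto> q (h n x)\<close>, where \<open>q (h n x)\<close> is the first point of the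
  dense sequence at distance less than \<open>1 / 2 ^ n\<close> from \<open>x\<close>. The level sets \<open>H n k\<close> of these maps differ by null sets
  from sets \<open>A n k\<close> in the \<open>\<sigma>\<close>-algebra generated by the coordinates, so a countable family of coordinates \<open>F\<close> and sets
  \<open>C n k\<close> satisfy \<open>A n k = {F \<in> C n k}\<close>. Reading off the index from these sets gives maps
  \<open>y \<mapsto> q (\<kappa> n y)\<close> with \<open>\<kappa> n (F x) = h n x\<close> for almost every \<open>x\<close>. They converge on the measurable set \<open>G\<close>
  where consecutive terms are geometrically close, and \<open>g\<close> is their limit there.
\<close>

lemma (in polish_measure) countable_subfamily_retraction:
  fixes f :: "'t \<Rightarrow> 'a \<Rightarrow> real"
  assumes f: "\<And>t. t \<in> T \<Longrightarrow> f t \<in> borel_measurable M"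
    and gen: "\<And>B. B \<in> sets M \<Longrightarrow>
      \<exists>A\<in>sigma_sets (space M) (\<Union>t\<in>T. {f t -` S \<inter> space M | S. S \<in> sets borel}).
        emeasure M ((A - B) \<union> (B - A)) = 0"
  obtains S where "countable S" "S \<subseteq> T"
    "\<And>S'. S \<subseteq> S' \<Longrightarrow> S' \<subseteq> T \<Longrightarrow>
      \<exists>g\<in>measurable (Pi\<^sub>M S' (\<lambda>_. borel)) M. AE x in M. g (\<lambda>t\<in>S'. f t x) = x"
proof -
  define \<delta> where "\<delta> n = (1 / 2 :: real) ^ n" for n :: nat
  have \<delta>_pos: "0 < \<delta> n" and \<delta>_Suc: "\<delta> (Suc n) = \<delta> n / 2" for n
    by (simp_all add: \<delta>_def)
  have \<delta>_lim: "\<delta> \<longlonglongrightarrow> 0"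
    unfolding \<delta>_def by (rule LIMSEQ_power_zero) simp
  define h where "h n x = (LEAST k. d (q k) x < \<delta> n)" for n x
  have h: "d (q (h n x)) x < \<delta> n" if "x \<in> space M" for n x
    unfolding h_def using q_dense[OF that \<delta>_pos] by (rule LeastI_ex)
  define H where "H n k = {x \<in> space M. h n x = k}" for n k
  have [measurable]: "h n \<in> measurable M (count_space UNIV)" for n
    unfolding h_def by measurable
  have H[measurable]: "H n k \<in> sets M" for n k
    unfolding H_def by measurable
  let ?\<F> = "\<Union>t\<in>T. {f t -` S \<inter> space M | S. S \<in> sets borel}"
  have "\<exists>A. \<forall>p. A p \<in> sigma_sets (space M) ?\<F> \<and>
      emeasure M ((A p - H (fst p) (snd p)) \<union> (H (fst p) (snd p) - A p)) = 0"
    by (intro choice allI) (use gen[OF H] in blast)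
  then obtain A' where A': "\<forall>p. A' p \<in> sigma_sets (space M) ?\<F> \<and>
      emeasure M ((A' p - H (fst p) (snd p)) \<union> (H (fst p) (snd p) - A' p)) = 0" ..
  define A where "A n k = A' (n, k)" for n k
  have A: "A n k \<in> sigma_sets (space M) ?\<F>" "emeasure M ((A n k - H n k) \<union> (H n k - A n k)) = 0" for n k
    using A'[rule_format, of "(n, k)"] by (simp_all add: A_def)
  have "sigma_sets (space M) ?\<F> \<subseteq> sets M"
    using f by (intro sets.sigma_sets_subset) (auto intro: measurable_sets)
  then have A_sets[measurable]: "A n k \<in> sets M" for n k
    using A(1) by blast
  have A_AE: "AE x in M. x \<in> A n k \<longleftrightarrow> h n x = k" for n k
  proof -
    have "AE x in M. x \<notin> (A n k - H n k) \<union> (H n k - A n k)"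
      using A(2) by (intro AE_not_in) auto
    then show ?thesis
      using AE_space by eventually_elim (auto simp: H_def)
  qed
  have "\<exists>Sp. \<forall>p. countable (Sp p) \<and> Sp p \<subseteq> T \<and> (\<forall>S'. Sp p \<subseteq> S' \<longrightarrow>
      (\<exists>C\<in>sets (Pi\<^sub>M S' (\<lambda>_. borel)). A' p = {x \<in> space M. (\<lambda>t\<in>S'. f t x) \<in> C}))"
    using A' by (intro choice allI generated_set_depends_on_countably_many f) auto
  then obtain Sp where Sp: "\<forall>p. countable (Sp p) \<and> Sp p \<subseteq> T \<and> (\<forall>S'. Sp p \<subseteq> S' \<longrightarrow>
      (\<exists>C\<in>sets (Pi\<^sub>M S' (\<lambda>_. borel)). A' p = {x \<in> space M. (\<lambda>t\<in>S'. f t x) \<in> C}))" ..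
  show ?thesis
  proof (rule that)
    show "countable (\<Union>p. Sp p)" "(\<Union>p. Sp p) \<subseteq> T"
      using Sp by auto
    fix S' assume S': "(\<Union>p. Sp p) \<subseteq> S'" "S' \<subseteq> T"
    let ?P = "Pi\<^sub>M S' (\<lambda>_. borel :: real measure)"
    define F where "F x = (\<lambda>t\<in>S'. f t x)" for x
    have F[measurable]: "F \<in> measurable M ?P"
      unfolding F_def using f S' by (intro measurable_restrict) auto
    have "\<exists>C. \<forall>p. C p \<in> sets ?P \<and> A' p = {x \<in> space M. F x \<in> C p}"
    proof (intro choice allI)
      fix p
      have "Sp p \<subseteq> S'"
        using S' by auto
      then show "\<exists>C. C \<in> sets ?P \<and> A' p = {x \<in> space M. F x \<in> C}"
        using Sp[THEN spec, of p] by (auto simp: F_def)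
    qed
    then obtain C' where C': "\<forall>p. C' p \<in> sets ?P \<and> A' p = {x \<in> space M. F x \<in> C' p}" ..
    define C where "C n k = C' (n, k)" for n k
    have C[measurable]: "C n k \<in> sets ?P" and A_eq: "A n k = {x \<in> space M. F x \<in> C n k}" for n k
      using C'[rule_format, of "(n, k)"] by (simp_all add: C_def A_def)
    \<comment> \<open>If \<open>y\<close> lies in no \<open>C n k\<close>, the value of \<open>\<kappa> n y\<close> is arbitrary; for almost every \<open>x\<close> and every \<open>n\<close>,
      exactly one of the sets \<open>C n k\<close> contains \<open>F x\<close>.\<close>
    define \<kappa> where "\<kappa> n y = (LEAST k. y \<in> C n k)" for n y
    have \<kappa>[measurable]: "\<kappa> n \<in> measurable ?P (count_space UNIV)" for n
      unfolding \<kappa>_def by measurable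
    have \<kappa>_h: "AE x in M. \<forall>n. \<kappa> n (F x) = h n x"
    proof -
      have "AE x in M. \<forall>n k. x \<in> A n k \<longleftrightarrow> h n x = k"
        unfolding AE_all_countable using A_AE by blast
      then show ?thesis
        using AE_space
      proof eventually_elim
        case (elim x)
        then have "F x \<in> C n k \<longleftrightarrow> h n x = k" for n k
          by (simp add: A_eq)
        then show ?case
          by (simp add: \<kappa>_def Least_equality)
      qed
    qed
    define G where "G = {y \<in> space ?P. \<forall>n. d (q (\<kappa> n y)) (q (\<kappa> (Suc n) y)) < 2 * \<delta> n}"
    have [measurable]: "(\<lambda>y. d (q (\<kappa> m y)) (q (\<kappa> n y))) \<in> borel_measurable ?P" for m n
      by measurable
    have G[measurable]: "G \<in> sets ?P"
      unfolding G_def by measurable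
    have "\<exists>l\<in>space M. (\<lambda>n. d (q (\<kappa> n y)) l) \<longlonglongrightarrow> 0" if y: "y \<in> G" for y
    proof (rule complete)
      show "q (\<kappa> n y) \<in> space M" for n
        by (rule q_in_space)
      \<comment> \<open>The bound \<open>2 * \<delta> n\<close> on consecutive terms telescopes to \<open>4 * \<delta> n\<close>.\<close>
      have tail: "d (q (\<kappa> n y)) (q (\<kappa> (n + j) y)) \<le> 4 * \<delta> n - 4 * \<delta> (n + j)" for n j
      proof (induction j)
        case (Suc j)
        have "d (q (\<kappa> n y)) (q (\<kappa> (n + Suc j) y)) \<le>
            d (q (\<kappa> n y)) (q (\<kappa> (n + j) y)) + d (q (\<kappa> (n + j) y)) (q (\<kappa> (Suc (n + j)) y))"
          using triangle q_in_space by simp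
        also have "\<dots> \<le> 4 * \<delta> n - 4 * \<delta> (n + j) + 2 * \<delta> (n + j)"
          using Suc y by (intro add_mono) (auto simp: G_def less_imp_le)
        finally show ?case
          by (simp add: \<delta>_Suc)
      qed (simp add: q_in_space)
      fix e :: real assume e: "0 < e"
      then have "\<forall>\<^sub>F n in sequentially. \<delta> n < e / 8"
        by (intro order_tendstoD(2)[OF \<delta>_lim]) simp
      then obtain N where N: "\<delta> N < e / 8"
        by (auto simp: eventually_sequentially)
      have near: "d (q (\<kappa> N y)) (q (\<kappa> n y)) < e / 2" if "N \<le> n" for n
        using tail[of N "n - N"] that N \<delta>_pos[of n] by simp
      show "\<exists>N. \<forall>m\<ge>N. \<forall>n\<ge>N. d (q (\<kappa> m y)) (q (\<kappa> n y)) < e"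
      proof (intro exI[of _ N] allI impI)
        fix m n assume mn: "N \<le> m" "N \<le> n"
        have "d (q (\<kappa> m y)) (q (\<kappa> n y)) \<le> d (q (\<kappa> N y)) (q (\<kappa> m y)) + d (q (\<kappa> N y)) (q (\<kappa> n y))"
          using triangle[of "q (\<kappa> m y)" "q (\<kappa> N y)" "q (\<kappa> n y)"] q_in_space commute[of "q (\<kappa> m y)" "q (\<kappa> N y)"] by simp
        also have "\<dots> < e"
          using near[OF mn(1)] near[OF mn(2)] by simp
        finally show "d (q (\<kappa> m y)) (q (\<kappa> n y)) < e" .
      qed
    qed
    then obtain l where l: "\<And>y. y \<in> G \<Longrightarrow> l y \<in> space M" "\<And>y. y \<in> G \<Longrightarrow> (\<lambda>n. d (q (\<kappa> n y)) (l y)) \<longlonglongrightarrow> 0"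
      by metis
    have dist_lim: "(\<lambda>n. d x (u n)) \<longlonglongrightarrow> d x z"
      if "x \<in> space M" "z \<in> space M" "\<And>n. u n \<in> space M" "(\<lambda>n. d (u n) z) \<longlonglongrightarrow> 0" for x z u
    proof (rule LIM_zero_cancel, rule tendsto_rabs_zero_cancel, rule tendsto_sandwich[OF _ _ tendsto_const that(4)])
      show "\<forall>\<^sub>F n in sequentially. \<bar>d x (u n) - d x z\<bar> \<le> d (u n) z"
      proof (intro always_eventually allI)
        fix n
        show "\<bar>d x (u n) - d x z\<bar> \<le> d (u n) z"
          using triangle[of x "u n" z] triangle[of x z "u n"] that(1-3) commute[of z "u n"] by (simp add: abs_le_iff)
      qed
    qed simp
    define g where "g y = (if y \<in> G then l y else q 0)" for y
    have g[measurable]: "g \<in> measurable ?P M"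
    proof (rule measurable_into)
      show "g y \<in> space M" for y
        using l q_in_space by (simp add: g_def)
      fix k
      show "(\<lambda>y. d (q k) (g y)) \<in> borel_measurable ?P"
      proof (rule borel_measurable_LIMSEQ_real)
        show "(\<lambda>n. if y \<in> G then d (q k) (q (\<kappa> n y)) else d (q k) (q 0)) \<longlonglongrightarrow> d (q k) (g y)" for y
          using l dist_lim q_in_space by (auto simp: g_def)
        show "(\<lambda>y. if y \<in> G then d (q k) (q (\<kappa> n y)) else d (q k) (q 0)) \<in> borel_measurable ?P" for n
          by (intro measurable_If_set measurable_compose[OF \<kappa>[of n]]) auto
      qed
    qed
    have "AE x in M. g (F x) = x"
      using \<kappa>_h AE_space
    proof eventually_elim
      case (elim x)
      have FG: "F x \<in> G"
        unfolding G_def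
      proof (intro CollectI conjI allI)
        show "F x \<in> space ?P"
          using F elim(2) by (rule measurable_space)
        fix n
        have "d (q (h n x)) (q (h (Suc n) x)) \<le> d (q (h n x)) x + d (q (h (Suc n) x)) x"
          using triangle[of "q (h n x)" x "q (h (Suc n) x)"] q_in_space elim(2) commute[of x "q (h (Suc n) x)"] by simp
        also have "\<dots> < \<delta> n + \<delta> (Suc n)"
          by (intro add_strict_mono h elim(2))
        also have "\<dots> \<le> 2 * \<delta> n"
          using \<delta>_pos[of n] by (simp add: \<delta>_Suc)
        finally show "d (q (\<kappa> n (F x))) (q (\<kappa> (Suc n) (F x))) < 2 * \<delta> n"
          using elim(1) by simp
      qed
      have "(\<lambda>n. d (q (h n x)) x) \<longlonglongrightarrow> 0"
        by (rule tendsto_sandwich[OF _ _ tendsto_const \<delta>_lim])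
          (simp_all add: less_imp_le h elim(2))
      then have "(\<lambda>n. d (l (F x)) (q (h n x))) \<longlonglongrightarrow> d (l (F x)) x"
        by (intro dist_lim[OF l(1)[OF FG] elim(2)] q_in_space)
      moreover have "(\<lambda>n. d (l (F x)) (q (h n x))) \<longlonglongrightarrow> 0"
        using l(2)[OF FG] elim(1) by (simp add: commute)
      ultimately have "d (l (F x)) x = 0"
        by (rule LIMSEQ_unique)
      then show ?case
        using FG l(1)[OF FG] elim(2) by (simp add: g_def)
    qed
    then show "\<exists>g\<in>measurable ?P M. AE x in M. g (\<lambda>t\<in>S'. f t x) = x"
      using g by (auto simp: F_def)
  qed
qed

section \<open>Maps that intertwine two families\<close>

text \<open>
  Both the image measure of \<open>\<omega> \<mapsto> g (\<lambda>t\<in>S. f2 t \<omega>)\<close> and the relation between \<open>f1 t\<close> and \<open>f2 t\<close> are properties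
  of the law of the family over \<open>insert t S\<close>, and on the first space they hold since \<open>g\<close> recovers the point.
\<close>

lemma intertwines_retraction:
  fixes f1 :: "'t \<Rightarrow> 'a \<Rightarrow> real" and f2 :: "'t \<Rightarrow> 'b \<Rightarrow> real"
  assumes f1: "\<And>t. t \<in> T \<Longrightarrow> f1 t \<in> borel_measurable M1" and f2: "\<And>t. t \<in> T \<Longrightarrow> f2 t \<in> borel_measurable M2"
    and S: "countable S" "S \<subseteq> T"
    and law: "\<And>S'. countable S' \<Longrightarrow> S \<subseteq> S' \<Longrightarrow> S' \<subseteq> T \<Longrightarrow>
      distr M1 (Pi\<^sub>M S' (\<lambda>_. borel)) (\<lambda>x. \<lambda>t\<in>S'. f1 t x) = distr M2 (Pi\<^sub>M S' (\<lambda>_. borel)) (\<lambda>x. \<lambda>t\<in>S'. f2 t x)"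
    and g[measurable]: "g \<in> measurable (Pi\<^sub>M S (\<lambda>_. borel)) M1" and retr: "AE x in M1. g (\<lambda>t\<in>S. f1 t x) = x"
  shows "intertwines T M1 f1 M2 f2 (\<lambda>\<omega>. g (\<lambda>t\<in>S. f2 t \<omega>))"
proof -
  let ?P = "Pi\<^sub>M S (\<lambda>_. borel :: real measure)"
  have F1[measurable]: "(\<lambda>x. \<lambda>t\<in>S. f1 t x) \<in> measurable M1 ?P" and F2[measurable]: "(\<lambda>x. \<lambda>t\<in>S. f2 t x) \<in> measurable M2 ?P"
    using f1 f2 S by (auto intro!: measurable_restrict)
  show ?thesis
    unfolding intertwines_def
  proof (intro conjI ballI)
    show "(\<lambda>\<omega>. g (\<lambda>t\<in>S. f2 t \<omega>)) \<in> measurable M2 M1"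
      by measurable
    have "distr M2 M1 (\<lambda>\<omega>. g (\<lambda>t\<in>S. f2 t \<omega>)) = distr (distr M2 ?P (\<lambda>\<omega>. \<lambda>t\<in>S. f2 t \<omega>)) M1 g"
      by (subst distr_distr) (auto simp: comp_def)
    also have "\<dots> = distr (distr M1 ?P (\<lambda>x. \<lambda>t\<in>S. f1 t x)) M1 g"
      using law[OF S(1) order_refl S(2)] by simp
    also have "\<dots> = distr M1 M1 (\<lambda>x. g (\<lambda>t\<in>S. f1 t x))"
      by (subst distr_distr) (auto simp: comp_def)
    also have "\<dots> = distr M1 M1 (\<lambda>x. x)"
      using retr by (intro distr_cong_AE) auto
    also have "\<dots> = M1"
      by (rule distr_id)
    finally show "M1 = distr M2 M1 (\<lambda>\<omega>. g (\<lambda>t\<in>S. f2 t \<omega>))" ..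
    fix t assume t: "t \<in> T"
    let ?S' = "insert t S"
    let ?P' = "Pi\<^sub>M ?S' (\<lambda>_. borel :: real measure)"
    have [measurable]: "f1 t \<in> borel_measurable M1"
      by (rule f1[OF t])
    have F1': "(\<lambda>x. \<lambda>t\<in>?S'. f1 t x) \<in> measurable M1 ?P'" and F2': "(\<lambda>x. \<lambda>t\<in>?S'. f2 t x) \<in> measurable M2 ?P'"
      using f1 f2 S t by (auto intro!: measurable_restrict)
    have [measurable]: "(\<lambda>y. restrict y S) \<in> measurable ?P' ?P"
      by (rule measurable_restrict_subset) auto
    have E: "{y \<in> space ?P'. y t = f1 t (g (restrict y S))} \<in> sets ?P'"
      by measurable
    have "AE y in distr M1 ?P' (\<lambda>x. \<lambda>t\<in>?S'. f1 t x). y t = f1 t (g (restrict y S))"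
    proof (subst AE_distr_iff[OF F1' E])
      show "AE x in M1. (\<lambda>t\<in>?S'. f1 t x) t = f1 t (g (restrict (\<lambda>t\<in>?S'. f1 t x) S))"
        using retr by eventually_elim (simp add: Int_absorb1 subset_insertI)
    qed
    moreover have "distr M1 ?P' (\<lambda>x. \<lambda>t\<in>?S'. f1 t x) = distr M2 ?P' (\<lambda>x. \<lambda>t\<in>?S'. f2 t x)"
      using S t by (intro law) auto
    ultimately have "AE y in distr M2 ?P' (\<lambda>x. \<lambda>t\<in>?S'. f2 t x). y t = f1 t (g (restrict y S))"
      by (simp only:)
    then have "AE \<omega> in M2. (\<lambda>t\<in>?S'. f2 t \<omega>) t = f1 t (g (restrict (\<lambda>t\<in>?S'. f2 t \<omega>) S))"
      by (subst (asm) AE_distr_iff[OF F2' E])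
    then show "AE \<omega> in M2. f2 t \<omega> = f1 t (g (\<lambda>t\<in>S. f2 t \<omega>))"
      by (simp add: Int_absorb1 subset_insertI)
  qed
qed

lemma intertwines_AE_family:
  assumes \<Phi>: "intertwines T M1 f1 M2 f2 \<Phi>" and S: "countable S" "S \<subseteq> T"
  shows "AE \<omega> in M2. (\<lambda>t\<in>S. f2 t \<omega>) = (\<lambda>t\<in>S. f1 t (\<Phi> \<omega>))"
proof -
  have "AE \<omega> in M2. \<forall>t\<in>S. f2 t \<omega> = f1 t (\<Phi> \<omega>)"
    using \<Phi> S by (subst AE_ball_countable) (auto simp: intertwines_def)
  then show ?thesis
    by eventually_elim (auto intro!: restrict_ext)
qed

text \<open>
  The relation \<open>g (\<lambda>t\<in>S. f1 t x) = x\<close> is pulled back along \<open>\<Phi>\<close>, which is allowed as \<open>\<Phi>\<close> carries \<open>M2\<close>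
  to \<open>M1\<close>; the values \<open>f1 t (\<Phi> \<omega>)\<close> that appear are those of \<open>f2 t\<close>.
\<close>

lemma intertwines_eq_retraction:
  assumes \<Phi>: "intertwines T M1 f1 M2 f2 \<Phi>" and S: "countable S" "S \<subseteq> T"
    and retr: "AE x in M1. g (\<lambda>t\<in>S. f1 t x) = x"
  shows "AE \<omega> in M2. \<Phi> \<omega> = g (\<lambda>t\<in>S. f2 t \<omega>)"
proof -
  have \<Phi>_meas: "\<Phi> \<in> measurable M2 M1" and M1: "M1 = distr M2 M1 \<Phi>"
    using \<Phi> by (simp_all add: intertwines_def)
  have "AE x in distr M2 M1 \<Phi>. g (\<lambda>t\<in>S. f1 t x) = x"
    by (subst M1[symmetric]) (rule retr)
  then have "AE \<omega> in M2. g (\<lambda>t\<in>S. f1 t (\<Phi> \<omega>)) = \<Phi> \<omega>"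
    by (rule AE_distrD[OF \<Phi>_meas])
  then show ?thesis
    using intertwines_AE_family[OF \<Phi> S] by eventually_elim simp
qed

text \<open>
  The candidate inverse is \<open>\<Psi> = g \<circ> (f1 t)\<^sub>t\<^sub>\<in>\<^sub>S\<close>, and \<open>\<Psi> \<circ> \<Phi> = id\<close> holds almost everywhere because
  \<open>f1 t \<circ> \<Phi> = f2 t\<close>. The exceptional sets are chosen as the complements of the fixed-point sets \<open>Z2\<close> of \<open>\<Psi> \<circ> \<Phi>\<close> and
  \<open>Z1\<close> of \<open>\<Phi> \<circ> \<Psi>\<close>, which \<open>\<Phi>\<close> and \<open>\<Psi>\<close> exchange bijectively. They are measurable as equality sets of measurable
  maps into separable metric spaces, and \<open>Z1\<close> has full measure because \<open>\<Phi>\<close> maps \<open>Z2\<close> into it.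
\<close>

lemma intertwines_imp_isomorphism:
  fixes f1 :: "'t \<Rightarrow> 'a \<Rightarrow> real" and f2 :: "'t \<Rightarrow> 'b \<Rightarrow> real"
  assumes pol1: "polish_measure M1 d1 q1" and pol2: "polish_measure M2 d2 q2"
    and f1: "\<And>t. t \<in> T \<Longrightarrow> f1 t \<in> borel_measurable M1"
    and \<Phi>: "intertwines T M1 f1 M2 f2 \<Phi>" and S: "countable S" "S \<subseteq> T"
    and g[measurable]: "g \<in> measurable (Pi\<^sub>M S (\<lambda>_. borel)) M2" and retr: "AE \<omega> in M2. g (\<lambda>t\<in>S. f2 t \<omega>) = \<omega>"
  shows "measure_space_isomorphism M2 M1 \<Phi>"
proof -
  have \<Phi>_meas[measurable]: "\<Phi> \<in> measurable M2 M1" and M1: "M1 = distr M2 M1 \<Phi>"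
    using \<Phi> by (simp_all add: intertwines_def)
  define \<Psi> where "\<Psi> x = g (\<lambda>t\<in>S. f1 t x)" for x
  have "(\<lambda>x. \<lambda>t\<in>S. f1 t x) \<in> measurable M1 (Pi\<^sub>M S (\<lambda>_. borel))"
    using f1 S by (auto intro!: measurable_restrict)
  then have \<Psi>_meas[measurable]: "\<Psi> \<in> measurable M1 M2"
    unfolding \<Psi>_def by measurable
  define Z2 where "Z2 = {\<omega> \<in> space M2. \<Psi> (\<Phi> \<omega>) = \<omega>}"
  define Z1 where "Z1 = {x \<in> space M1. \<Phi> (\<Psi> x) = x}"
  have Z2[measurable]: "Z2 \<in> sets M2"
    unfolding Z2_def by (rule polish_measure.sets_Collect_eq[OF pol2]) measurable
  have Z1[measurable]: "Z1 \<in> sets M1"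
    unfolding Z1_def by (rule polish_measure.sets_Collect_eq[OF pol1]) measurable
  have \<Phi>_Z: "\<Phi> \<omega> \<in> Z1" "\<Psi> (\<Phi> \<omega>) = \<omega>" if "\<omega> \<in> Z2" for \<omega>
    using that measurable_space[OF \<Phi>_meas, of \<omega>] by (auto simp: Z1_def Z2_def)
  have \<Psi>_Z: "\<Psi> x \<in> Z2" "\<Phi> (\<Psi> x) = x" if "x \<in> Z1" for x
    using that measurable_space[OF \<Psi>_meas, of x] by (auto simp: Z1_def Z2_def)
  have AE_Z2: "AE \<omega> in M2. \<omega> \<in> Z2"
    using intertwines_AE_family[OF \<Phi> S] retr AE_space
    by eventually_elim (simp add: Z2_def \<Psi>_def)
  have "AE \<omega> in M2. \<omega> \<notin> space M2 - Z2"
    using AE_Z2 by eventually_elim auto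
  then have null2: "space M2 - Z2 \<in> null_sets M2"
    by (subst AE_iff_null_sets) auto
  have em: "emeasure M1 E = emeasure M2 (\<Phi> -` E \<inter> space M2)" if "E \<in> sets M1" for E
    using emeasure_distr[OF \<Phi>_meas that] M1 by simp
  have "emeasure M1 (space M1 - Z1) = emeasure M2 (\<Phi> -` (space M1 - Z1) \<inter> space M2)"
    by (rule em) auto
  also have "\<dots> \<le> emeasure M2 (space M2 - Z2)"
    using \<Phi>_Z by (intro emeasure_mono) auto
  also have "\<dots> = 0"
    using null2 by auto
  finally have null1: "space M1 - Z1 \<in> null_sets M1"
    by (intro null_setsI) auto
  have sub: "Z2 \<subseteq> space M2" "Z1 \<subseteq> space M1"
    by (auto simp: Z1_def Z2_def)
  then have diff: "space M2 - (space M2 - Z2) = Z2" "space M1 - (space M1 - Z1) = Z1"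
    by auto
  have bij: "bij_betw \<Phi> Z2 Z1"
    by (rule bij_betw_byWitness[where f'=\<Psi>]) (use \<Phi>_Z \<Psi>_Z in auto)
  have inv: "the_inv_into Z2 \<Phi> x = \<Psi> x" if "x \<in> Z1" for x
    using \<Psi>_Z[OF that] bij by (intro the_inv_into_f_eq) (auto simp: bij_betw_def)
  have space: "space (restrict_space M2 Z2) = Z2" "space (restrict_space M1 Z1) = Z1"
    using sub by (auto simp: space_restrict_space)
  show ?thesis
    unfolding measure_space_isomorphism_def
  proof (intro bexI[OF _ null2] bexI[OF _ null1] conjI ballI impI)
    show "bimeasurable_bijection (restrict_space M2 (space M2 - (space M2 - Z2))) (restrict_space M1 (space M1 - (space M1 - Z1))) \<Phi>"
      unfolding diff bimeasurable_bijection_def space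
    proof (intro conjI bij)
      show "\<Phi> \<in> measurable (restrict_space M2 Z2) (restrict_space M1 Z1)"
        using \<Phi>_Z by (intro measurable_restrict_space3) auto
      have "\<Psi> \<in> measurable (restrict_space M1 Z1) (restrict_space M2 Z2)"
        using \<Psi>_Z by (intro measurable_restrict_space3) auto
      then show "the_inv_into Z2 \<Phi> \<in> measurable (restrict_space M1 Z1) (restrict_space M2 Z2)"
        using inv by (subst measurable_cong[where g=\<Psi>]) (auto simp: space)
    qed
    fix E assume E[measurable]: "E \<in> sets M2" and "E \<subseteq> space M2 - (space M2 - Z2)"
    then have EZ: "E \<subseteq> Z2"
      by auto
    have img: "\<Phi> ` E = \<Psi> -` E \<inter> space M1 \<inter> Z1"
    proof (intro equalityI subsetI)
      fix x assume "x \<in> \<Phi> ` E"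
      then obtain \<omega> where \<omega>: "\<omega> \<in> E" "x = \<Phi> \<omega>"
        by blast
      then have "\<omega> \<in> Z2"
        using EZ by blast
      from \<Phi>_Z[OF this] \<omega> sub(2) show "x \<in> \<Psi> -` E \<inter> space M1 \<inter> Z1"
        by auto
    next
      fix x assume "x \<in> \<Psi> -` E \<inter> space M1 \<inter> Z1"
      then show "x \<in> \<Phi> ` E"
        using \<Psi>_Z by (metis IntD1 IntD2 image_eqI vimageD)
    qed
    have img_sets: "\<Phi> ` E \<in> sets M1"
      unfolding img by measurable
    have "emeasure M1 (\<Phi> ` E) = emeasure M2 (\<Phi> -` (\<Phi> ` E) \<inter> space M2)"
      by (rule em[OF img_sets])
    also have "\<dots> = emeasure M2 E"
    proof (rule emeasure_eq_AE)
      show "AE \<omega> in M2. \<omega> \<in> \<Phi> -` (\<Phi> ` E) \<inter> space M2 \<longleftrightarrow> \<omega> \<in> E"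
        using AE_Z2
      proof eventually_elim
        case (elim \<omega>)
        then show ?case
          using EZ sub \<Phi>_Z(2) by (auto, metis subsetD)
      qed
    qed (use measurable_sets[OF \<Phi>_meas img_sets] in auto)
    finally show "emeasure M2 E = emeasure M1 (\<Phi> ` E)" ..
  qed
qed

section \<open>Uniqueness of minimal spectral representations\<close>

theorem theorem2p17:
  fixes T :: "'t set"
    and P :: "'p measure" and X :: "'t \<Rightarrow> 'p \<Rightarrow> real"
    and M1 :: "'a measure" and f1 :: "'t \<Rightarrow> 'a \<Rightarrow> real"
    and M2 :: "'b measure" and f2 :: "'t \<Rightarrow> 'b \<Rightarrow> real"
  assumes "prob_space P"
    and "\<And>t. t \<in> T \<Longrightarrow> X t \<in> borel_measurable P"
    and "infinitely_divisible T P X"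
    and "trivial_gaussian_component T P X"
    and "sigma_finite_measure M1" and "sigma_finite_measure M2"
    and "minimal_spectral_representation T P X M1 f1"
    and "minimal_spectral_representation T P X M2 f2"
  shows "(sigma_finite_borel_space M1 \<longrightarrow> (\<exists>\<Phi>. intertwines T M1 f1 M2 f2 \<Phi>)) \<and>
    (sigma_finite_borel_space M1 \<and> sigma_finite_borel_space M2 \<longrightarrow>
      (\<forall>\<Phi>. intertwines T M1 f1 M2 f2 \<Phi> \<longrightarrow>
        measure_space_isomorphism M2 M1 \<Phi> \<and>
        (\<forall>\<Psi>. intertwines T M1 f1 M2 f2 \<Psi> \<longrightarrow> (AE \<omega> in M2. \<Psi> \<omega> = \<Phi> \<omega>))))"
proof -
  have spec1: "spectral_representation T P X M1 f1" and min1: "minimal_family T M1 f1"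
    and spec2: "spectral_representation T P X M2 f2" and min2: "minimal_family T M2 f2"
    using assms(7,8) by (simp_all add: minimal_spectral_representation_def)
  have L1: "f1 t \<in> L_plus M1" and L2: "f2 t \<in> L_plus M2" if "t \<in> T" for t
    using spec1 spec2 that by (simp_all add: spectral_representation_def)
  have f1: "f1 t \<in> borel_measurable M1" and f2: "f2 t \<in> borel_measurable M2" if "t \<in> T" for t
    using L1 L2 that by (auto intro: L_plus_measurable)
  obtain c1 where c1: "\<And>F \<theta>. finite F \<Longrightarrow> F \<subseteq> T \<Longrightarrow>
      (\<integral>\<omega>. iexp (\<Sum>t\<in>F. \<theta> t * X t \<omega>) \<partial>P) = exp (levy_exponent M1 f1 c1 F \<theta>)"
    by (rule spectral_representation_char[OF assms(2) spec1]) (assumption, rule that)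
  obtain c2 where c2: "\<And>F \<theta>. finite F \<Longrightarrow> F \<subseteq> T \<Longrightarrow>
      (\<integral>\<omega>. iexp (\<Sum>t\<in>F. \<theta> t * X t \<omega>) \<partial>P) = exp (levy_exponent M2 f2 c2 F \<theta>)"
    by (rule spectral_representation_char[OF assms(2) spec2]) (assumption, rule that)
  have exponent: "levy_exponent M1 f1 c1 F \<theta> = levy_exponent M2 f2 c2 F \<theta>" if F: "finite F" "F \<subseteq> T" for F \<theta>
    by (rule levy_exponent_unique) (use F L1 L2 c1[OF F] c2[OF F] in auto)
  have full1: "\<not> (\<exists>B\<in>sets M1. emeasure M1 B > 0 \<and> (\<forall>t\<in>T. AE x in M1. x \<in> B \<longrightarrow> f1 t x = 0))"
    using min1 by (simp add: minimal_family_def)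
  obtain C1 where C1: "countable C1" "C1 \<subseteq> T" "AE x in M1. \<exists>t\<in>C1. f1 t x \<noteq> 0"
    by (rule countable_subfamily_with_full_support[OF assms(5) f1 full1]) (assumption, rule that)
  have full2: "\<not> (\<exists>B\<in>sets M2. emeasure M2 B > 0 \<and> (\<forall>t\<in>T. AE x in M2. x \<in> B \<longrightarrow> f2 t x = 0))"
    using min2 by (simp add: minimal_family_def)
  obtain C2 where C2: "countable C2" "C2 \<subseteq> T" "AE x in M2. \<exists>t\<in>C2. f2 t x \<noteq> 0"
    by (rule countable_subfamily_with_full_support[OF assms(6) f2 full2]) (assumption, rule that)
  \<comment> \<open>Enlarging \<open>S\<close> keeps the origin null, so one \<open>S\<close> serves both families and may be extended by single
    indices later.\<close>
  have law: "distr M1 (Pi\<^sub>M S (\<lambda>_. borel)) (\<lambda>x. \<lambda>t\<in>S. f1 t x) = distr M2 (Pi\<^sub>M S (\<lambda>_. borel)) (\<lambda>x. \<lambda>t\<in>S. f2 t x)"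
    if S: "countable S" "C1 \<union> C2 \<subseteq> S" "S \<subseteq> T" for S
  proof (rule distr_eq_of_levy_exponent_eq)
    show "AE x in M1. \<exists>t\<in>S. f1 t x \<noteq> 0"
      using C1(3) by eventually_elim (use S in auto)
    show "AE x in M2. \<exists>t\<in>S. f2 t x \<noteq> 0"
      using C2(3) by eventually_elim (use S in auto)
    show "levy_exponent M1 f1 c1 F \<theta> = levy_exponent M2 f2 c2 F \<theta>" if "finite F" "F \<subseteq> S" for F \<theta>
      by (rule exponent) (use that S in auto)
  qed (use S L1 L2 in auto)
  have retraction1: "\<exists>S g. countable S \<and> C1 \<union> C2 \<subseteq> S \<and> S \<subseteq> T \<and>
      g \<in> measurable (Pi\<^sub>M S (\<lambda>_. borel)) M1 \<and> (AE x in M1. g (\<lambda>t\<in>S. f1 t x) = x)"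
    if b1: "sigma_finite_borel_space M1"
  proof -
    have "borel_space M1"
      using b1 by (simp add: sigma_finite_borel_space_def)
    then obtain d q where "polish_measure M1 d q"
      by (rule borel_space_imp_polish_measure)
    then interpret polish_measure M1 d q .
    obtain S where S: "countable S" "S \<subseteq> T" "\<And>S'. S \<subseteq> S' \<Longrightarrow> S' \<subseteq> T \<Longrightarrow>
        \<exists>g\<in>measurable (Pi\<^sub>M S' (\<lambda>_. borel)) M1. AE x in M1. g (\<lambda>t\<in>S'. f1 t x) = x"
      by (rule countable_subfamily_retraction[of T f1]) (use f1 min1 in \<open>auto simp: minimal_family_def\<close>)
    have "\<exists>g\<in>measurable (Pi\<^sub>M (S \<union> C1 \<union> C2) (\<lambda>_. borel)) M1. AE x in M1. g (\<lambda>t\<in>S \<union> C1 \<union> C2. f1 t x) = x"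
      by (rule S(3)) (use S C1 C2 in auto)
    then show ?thesis
      using S(1,2) C1(1,2) C2(1,2) by (intro exI[of _ "S \<union> C1 \<union> C2"]) auto
  qed
  show ?thesis
  proof (intro conjI impI allI; (elim conjE)?)
    assume "sigma_finite_borel_space M1"
    then obtain S g where S: "countable S" "C1 \<union> C2 \<subseteq> S" "S \<subseteq> T"
      and g: "g \<in> measurable (Pi\<^sub>M S (\<lambda>_. borel)) M1" "AE x in M1. g (\<lambda>t\<in>S. f1 t x) = x"
      using retraction1 by blast
    have law_S: "distr M1 (Pi\<^sub>M S' (\<lambda>_. borel)) (\<lambda>x. \<lambda>t\<in>S'. f1 t x) = distr M2 (Pi\<^sub>M S' (\<lambda>_. borel)) (\<lambda>x. \<lambda>t\<in>S'. f2 t x)"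
      if "countable S'" "S \<subseteq> S'" "S' \<subseteq> T" for S'
      by (rule law) (use that S in auto)
    have "intertwines T M1 f1 M2 f2 (\<lambda>\<omega>. g (\<lambda>t\<in>S. f2 t \<omega>))"
      by (rule intertwines_retraction[OF f1 f2 S(1,3) law_S g])
    then show "\<exists>\<Phi>. intertwines T M1 f1 M2 f2 \<Phi>"
      by blast
  next
    fix \<Phi>
    assume b1: "sigma_finite_borel_space M1" and b2: "sigma_finite_borel_space M2"
      and \<Phi>: "intertwines T M1 f1 M2 f2 \<Phi>"
    have "borel_space M1"
      using b1 by (simp add: sigma_finite_borel_space_def)
    then obtain d1 q1 where pol1: "polish_measure M1 d1 q1"
      by (rule borel_space_imp_polish_measure)
    have "borel_space M2"
      using b2 by (simp add: sigma_finite_borel_space_def)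
    then obtain d2 q2 where pol2: "polish_measure M2 d2 q2"
      by (rule borel_space_imp_polish_measure)
    obtain S where S: "countable S" "S \<subseteq> T" "\<And>S'. S \<subseteq> S' \<Longrightarrow> S' \<subseteq> T \<Longrightarrow>
        \<exists>g\<in>measurable (Pi\<^sub>M S' (\<lambda>_. borel)) M2. AE x in M2. g (\<lambda>t\<in>S'. f2 t x) = x"
      by (rule polish_measure.countable_subfamily_retraction[OF pol2, of T f2]) (use f2 min2 in \<open>auto simp: minimal_family_def\<close>)
    obtain g where "g \<in> measurable (Pi\<^sub>M S (\<lambda>_. borel)) M2" "AE x in M2. g (\<lambda>t\<in>S. f2 t x) = x"
      using S(3)[OF order_refl S(2)] by blast
    then show "measure_space_isomorphism M2 M1 \<Phi>"
      using intertwines_imp_isomorphism[OF pol1 pol2 f1 \<Phi> S(1,2)] by blast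
  next
    fix \<Phi> \<Psi>
    assume "sigma_finite_borel_space M1"
      and \<Phi>: "intertwines T M1 f1 M2 f2 \<Phi>" and \<Psi>: "intertwines T M1 f1 M2 f2 \<Psi>"
    then obtain S g where S: "countable S" "S \<subseteq> T" and g: "AE x in M1. g (\<lambda>t\<in>S. f1 t x) = x"
      using retraction1 by blast
    show "AE \<omega> in M2. \<Psi> \<omega> = \<Phi> \<omega>"
      using intertwines_eq_retraction[OF \<Psi> S g] intertwines_eq_retraction[OF \<Phi> S g]
      by eventually_elim simp
  qed
qed

end
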